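(* Let $f$ be a probability density on $\mathbb{R}^d$ satisfying the standing assumptions listed in the context. Suppose that $x$ is in the basin of attraction of a mode $x_*$ of $f$, i.e., $\gamma_x(t)\to x_*$ as $t\to\infty$. Then there is $\varepsilon_0>0$ (depending on $f$ and $x$) such that, for every $0<\varepsilon\le\varepsilon_0$, Algorithm 2 with step size $\varepsilon$ and starting point $x$ stops after finitely many steps and returns the mode $x_*$. Furthermore, as $\varepsilon\to 0$, the polygonal line connecting the sequence $(q_k)$ computed by the algorithm converges, in Hausdorff distance, to the gradient ascent line $\{\gamma_x(t): t\ge 0\}$ originating at $x$.
   Context: Standing assumptions on $f$: $f$ is a probability density with respect to Lebesgue measure on $\mathbb{R}^d$ such that (i) $f(x)\to 0$ as $\|x\|\to\infty$; (ii) $f$ is twice continuously differentiable everywhere, with $f$ and its first and second derivatives bounded; (iii) the Hessian of $f$ is non-singular at every critical point of $f$. A mode is a local maximum of $f$. The gradient flow: for $x\in\mathbb{R}^d$, $\gamma_x:[0,\infty)\to\mathbb{R}^d$ is the solution of $\gamma_x(0)=x$, $\dot\gamma_x(t)=\nabla f(\gamma_x(t))$. The basin of attraction of a point $x_0$ is $\{x:\lim_{t\to\infty}\gamma_x(t)=x_0\}$. For $t>0$, $\mathcal{L}_t:=\{y: f(y)=t\}$. A (metric) projection of a point $y$ onto a closed nonempty set $A$ is any point of $A$ at minimal Euclidean distance from $y$. Algorithm 2 (step size $\varepsilon>0$, starting point $x$): set $t_0=f(x)$ and $q_0=x$. For $k=1,2,\dots$: let $t_k=\max\{f(y):\|y-q_{k-1}\|\le\varepsilon\}$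 and let $q_k$ be a projection of $q_{k-1}$ onto $\mathcal{L}_{t_k}$ (any choice if it is not unique); if $q_k=q_{k-1}$, stop and return that point. The polygonal line connecting the sequence is $\bigcup_{k\ge1}[q_{k-1},q_k]$. The Hausdorff distance between $A,B\subset\mathbb{R}^d$ is $\max\{\sup_{a\in A}\inf_{b\in B}\|a-b\|,\ \sup_{b\in B}\inf_{a\in A}\|a-b\|\}$. *)

theory Defs
  imports "HOL-Analysis.Analysis"
begin

definition gradient :: "(real ^ 'n \<Rightarrow> real) \<Rightarrow> real ^ 'n \<Rightarrow> real ^ 'n"
  where "gradient f x = (THE D. GDERIV f x :> D)"

definition hessian :: "(real ^ 'n \<Rightarrow> real) \<Rightarrow> real ^ 'n \<Rightarrow> real ^ 'n ^ 'n"
  where "hessian f x = jacobian (gradient f) (at x)"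

definition twice_continuously_differentiable :: "(real ^ 'n \<Rightarrow> real) \<Rightarrow> bool"
  where "twice_continuously_differentiable f \<longleftrightarrow>
    (\<forall>x. f differentiable (at x)) \<and>
    (\<forall>x. gradient f differentiable (at x)) \<and>
    continuous_on UNIV (hessian f)"

definition probability_density :: "(real ^ 'n \<Rightarrow> real) \<Rightarrow> bool"
  where "probability_density f \<longleftrightarrow> (\<forall>x. 0 \<le> f x) \<and> has_bochner_integral lborel f 1"

definition standing_assumptions :: "(real ^ 'n \<Rightarrow> real) \<Rightarrow> bool"
  where "standing_assumptions f \<longleftrightarrow>
    probability_density f \<and>
    (f \<longlongrightarrow> 0) at_infinity \<and>
    twice_continuously_differentiable f \<and>
    bounded (range f) \<and> bounded (range (gradient f)) \<and> bounded (range (hessian f)) \<and>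
    (\<forall>x. gradient f x = 0 \<longrightarrow> invertible (hessian f x))"

definition mode :: "(real ^ 'n \<Rightarrow> real) \<Rightarrow> real ^ 'n \<Rightarrow> bool"
  where "mode f x \<longleftrightarrow> (\<exists>r>0. \<forall>y\<in>ball x r. f y \<le> f x)"

definition gradient_flow :: "(real ^ 'n \<Rightarrow> real) \<Rightarrow> real ^ 'n \<Rightarrow> (real \<Rightarrow> real ^ 'n) \<Rightarrow> bool"
  where "gradient_flow f x \<gamma> \<longleftrightarrow>
    \<gamma> 0 = x \<and> (\<forall>t\<ge>0. (\<gamma> has_vector_derivative gradient f (\<gamma> t)) (at t within {0..}))"

definition level_set :: "(real ^ 'n \<Rightarrow> real) \<Rightarrow> real \<Rightarrow> (real ^ 'n) set"
  where "level_set f t = {y. f y = t}"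

definition is_projection :: "(real ^ 'n) set \<Rightarrow> real ^ 'n \<Rightarrow> real ^ 'n \<Rightarrow> bool"
  where "is_projection A y p \<longleftrightarrow> is_arg_min (\<lambda>a. norm (y - a)) (\<lambda>a. a \<in> A) p"

definition ball_max :: "(real ^ 'n \<Rightarrow> real) \<Rightarrow> real \<Rightarrow> real ^ 'n \<Rightarrow> real"
  where "ball_max f \<epsilon> q = (GREATEST t. t \<in> f ` cball q \<epsilon>)"

definition algorithm_step :: "(real ^ 'n \<Rightarrow> real) \<Rightarrow> real \<Rightarrow> real ^ 'n \<Rightarrow> real ^ 'n \<Rightarrow> bool"
  where "algorithm_step f \<epsilon> q q' \<longleftrightarrow> is_projection (level_set f (ball_max f \<epsilon> q)) q q'"

definition stopped :: "(nat \<Rightarrow> real ^ 'n) \<Rightarrow> nat \<Rightarrow> bool"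
  where "stopped q k \<longleftrightarrow> (\<exists>j<k. q (Suc j) = q j)"

text \<open>Projections need not be unique, so a run is a sequence recording one admissible series of
  choices. A run that stops is continued by repeating the returned point; this adds only degenerate
  segments to its polygonal line.\<close>

definition algorithm_run ::
    "(real ^ 'n \<Rightarrow> real) \<Rightarrow> real \<Rightarrow> real ^ 'n \<Rightarrow> (nat \<Rightarrow> real ^ 'n) \<Rightarrow> bool"
  where "algorithm_run f \<epsilon> x q \<longleftrightarrow>
    q 0 = x \<and>
    (\<forall>k. if stopped q k then q (Suc k) = q k else algorithm_step f \<epsilon> (q k) (q (Suc k)))"

definition run_returns :: "(nat \<Rightarrow> real ^ 'n) \<Rightarrow> real ^ 'n \<Rightarrow> bool"
  where "run_returns q p \<longleftrightarrow> (\<exists>k. stopped q k \<and> q k = p)"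

definition polygonal_line :: "(nat \<Rightarrow> real ^ 'n) \<Rightarrow> (real ^ 'n) set"
  where "polygonal_line q = (\<Union>k. closed_segment (q k) (q (Suc k)))"

text \<open>Extended-real valued, because the real-valued \<open>Sup\<close> is unspecified on unbounded sets.\<close>

definition hausdorff_distance :: "(real ^ 'n) set \<Rightarrow> (real ^ 'n) set \<Rightarrow> ereal"
  where "hausdorff_distance A B =
    max (SUP a\<in>A. INF b\<in>B. ereal (norm (a - b))) (SUP b\<in>B. INF a\<in>A. ereal (norm (a - b)))"

end

(* Each step of the algorithm is a perturbed Euler step of the gradient flow. The new point maximises
   f on the ball of radius eps around q, and comparing its value with that at q + eps g/|g|, where
   g = grad f(q), by first-order Taylor expansion puts it within O(eps^(3/2)) of that point. A discrete
   Gronwall argument, with time step eps/|g|, then keeps the run close to the flow line up to any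
   fixed time. This needs grad f to stay away from 0 on the flow line, which holds because a
   flow line meeting a critical point is constant (then x is already the mode).

   At the mode p, nonsingularity and symmetry of the Hessian make it negative definite, so
   f(p) - f is at least quadratic nearby. A run that comes close to p therefore cannot leave, gains at
   least a constant times eps^2 in each step, and once within eps of p jumps onto it. *)
theory Submission
  imports Defs
begin

text \<open>The tracking error carries a factor \<open>exp (L * (T + 1))\<close> and requires a
  lower bound on the gradient up to time \<open>T + 1\<close>. Both degenerate as \<open>T\<close>
  grows, so tracking alone cannot follow a nonconstant flow line all the way to the mode. The order
  of choices resolves this: the target accuracy fixes a neighbourhood of the mode, the neighbourhood
  fixes \<open>T\<close>, and only then is \<epsilon> made small. After that time the flow line
  stays in the neighbourhood by convergence and the run by absorption, so the two need no further
  comparison there. For the Hausdorff distance it suffices to compare vertices with the flow line,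
  since an edge has length at most \<epsilon>.\<close>

section \<open>First-order estimates under a Lipschitz gradient\<close>

locale lipschitz_gradient =
  fixes f :: "real ^ 'n \<Rightarrow> real" and g :: "real ^ 'n \<Rightarrow> real ^ 'n" and L G :: real
  assumes gderiv: "GDERIV f y :> g y"
    and lipschitz: "norm (g y - g z) \<le> L * norm (y - z)"
    and bounded: "norm (g y) \<le> G"
    and L_pos: "0 < L" and G_pos: "0 < G"
begin

lemma isCont_f: "isCont f y"
  using gderiv[of y] unfolding gderiv_def by (rule has_derivative_continuous)

lemma continuous_on_f: "continuous_on S f"
  by (simp add: continuous_at_imp_continuous_on isCont_f)

lemma DERIV_on_line: "DERIV (\<lambda>s. f (y + s *\<^sub>R v)) s :> g (y + s *\<^sub>R v) \<bullet> v"
proof -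
  have "((\<lambda>s. f (y + s *\<^sub>R v)) has_derivative (\<lambda>h. (h *\<^sub>R v) \<bullet> g (y + s *\<^sub>R v))) (at s)"
    using gderiv[of "y + s *\<^sub>R v"] unfolding gderiv_def
    by (rule has_derivative_compose[rotated]) (auto intro!: derivative_eq_intros)
  then show ?thesis
    unfolding has_field_derivative_def by (simp add: inner_commute mult.commute[of _ "v \<bullet> _"])
qed

text \<open>The mean value theorem evaluates the gradient at an intermediate point of the segment.
  This costs a factor 2 against the sharp constant \<open>L / 2\<close> but needs no
  integral.\<close>

lemma first_order_expansion: "\<bar>f (y + v) - f y - g y \<bullet> v\<bar> \<le> L * (norm v)\<^sup>2"
proof -
  obtain s where s: "0 < s" "s < 1"
    and eq: "f (y + 1 *\<^sub>R v) - f (y + 0 *\<^sub>R v) = (1 - 0) * (g (y + s *\<^sub>R v) \<bullet> v)"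
    using MVT2[of 0 1 "\<lambda>s. f (y + s *\<^sub>R v)", OF _ DERIV_on_line] by auto
  have "\<bar>f (y + v) - f y - g y \<bullet> v\<bar> = \<bar>(g (y + s *\<^sub>R v) - g y) \<bullet> v\<bar>"
    using eq by (simp add: inner_diff_left)
  also have "\<dots> \<le> norm (g (y + s *\<^sub>R v) - g y) * norm v"
    by (rule Cauchy_Schwarz_ineq2)
  also have "\<dots> \<le> (L * norm v) * norm v"
  proof (rule mult_right_mono)
    have "norm (g (y + s *\<^sub>R v) - g y) \<le> L * norm (s *\<^sub>R v)"
      using lipschitz[of "y + s *\<^sub>R v" y] by simp
    also have "\<dots> \<le> L * norm v"
      using s L_pos by (simp add: mult_left_le_one_le)
    finally show "norm (g (y + s *\<^sub>R v) - g y) \<le> L * norm v" .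
  qed simp
  finally show ?thesis by (simp add: power2_eq_square mult.assoc)
qed

end

section \<open>Gradient flow lines: speed, Euler error and equilibria\<close>

locale lipschitz_gradient_flow = lipschitz_gradient +
  fixes \<gamma> :: "real \<Rightarrow> real ^ 'n"
  assumes flow: "0 \<le> t \<Longrightarrow> (\<gamma> has_vector_derivative g (\<gamma> t)) (at t within {0..})"
begin

lemma flow_lipschitz:
  assumes "0 \<le> s" "0 \<le> t"
  shows "norm (\<gamma> s - \<gamma> t) \<le> G * \<bar>s - t\<bar>"
proof -
  have "norm (\<gamma> s - \<gamma> t) \<le> G * norm (s - t)"
  proof (rule differentiable_bound)
    show "convex {0::real..}" by simp
    show "(\<gamma> has_derivative (\<lambda>h. h *\<^sub>R g (\<gamma> u))) (at u within {0..})" if "u \<in> {0..}" for u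
      using flow that by (simp add: has_vector_derivative_def)
    show "onorm (\<lambda>h. h *\<^sub>R g (\<gamma> u)) \<le> G" for u
      by (rule onorm_bound) (use bounded[of "\<gamma> u"] G_pos in
          \<open>auto simp: mult.commute[of G] intro: mult_left_mono\<close>)
  qed (use assms in auto)
  then show ?thesis by simp
qed

text \<open>In time \<open>h\<close> the flow line moves at most \<open>G * h\<close>, so its
  velocity drifts by at most \<open>L * G * h\<close> from the initial one; the second factor
  \<open>h\<close> is the length of the time interval.\<close>

lemma flow_euler_error:
  assumes "0 \<le> t" "0 \<le> h"
  shows "norm (\<gamma> (t + h) - \<gamma> t - h *\<^sub>R g (\<gamma> t)) \<le> L * G * h\<^sup>2"
proof -
  have "norm (\<gamma> (t + h) - \<gamma> t - (t + h - t) *\<^sub>R g (\<gamma> t)) \<le> norm (t + h - t) * (L * G * h)"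
  proof (rule vector_differentiable_bound_linearization)
    show "(\<gamma> has_vector_derivative g (\<gamma> u)) (at u within {t..t + h})" if "u \<in> {t..t + h}" for u
      using flow[of u] that assms by (auto intro: has_vector_derivative_within_subset)
    show "closed_segment t (t + h) \<subseteq> {t..t + h}"
      using assms by (simp add: closed_segment_eq_real_ivl)
    show "norm (g (\<gamma> u) - g (\<gamma> t)) \<le> L * G * h" if "u \<in> {t..t + h}" for u
    proof -
      have "norm (\<gamma> u - \<gamma> t) \<le> G * h"
        using flow_lipschitz[of u t] that assms G_pos
        by (auto intro: order.trans mult_left_mono)
      then have "L * norm (\<gamma> u - \<gamma> t) \<le> L * (G * h)"
        using L_pos by simp
      then show ?thesis
        using lipschitz[of "\<gamma> u" "\<gamma> t"] by (simp add: mult.assoc)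
    qed
  qed (use assms in auto)
  then show ?thesis using assms by (simp add: power2_eq_square mult_ac)
qed

lemma continuous_on_flow: "continuous_on {0..} \<gamma>"
  by (meson atLeast_iff continuous_on_eq_continuous_within flow has_vector_derivative_continuous)

lemma DERIV_norm_diff_squared:
  assumes "0 < t"
  shows "DERIV (\<lambda>t. (norm (\<gamma> t - p))\<^sup>2) t :> 2 * ((\<gamma> t - p) \<bullet> g (\<gamma> t))"
proof -
  \<comment> \<open>Inside \<open>{0..}\<close> the one-sided derivative of the flow is two-sided.
    At the endpoint 0 continuity will do.\<close>
  have "at t within {0..} = at t"
    using assms by (intro at_within_interior) (simp add: interior_Ici[of "t - 1"])
  then have [derivative_intros]: "(\<gamma> has_derivative (\<lambda>h. h *\<^sub>R g (\<gamma> t))) (at t)"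
    using flow[of t] assms by (simp add: has_vector_derivative_def)
  show ?thesis
    unfolding has_field_derivative_def power2_norm_eq_inner
    by (auto intro!: derivative_eq_intros simp: inner_commute)
qed

text \<open>Gronwall's argument forwards and backwards in time: along a trajectory the squared distance
  to an equilibrium grows and decays at rate at most \<open>2 * L\<close>.\<close>

lemma flow_constant_of_critical:
  assumes t0: "0 \<le> t0" and crit: "g (\<gamma> t0) = 0" and t: "0 \<le> t"
  shows "\<gamma> t = \<gamma> t0"
proof -
  define p where "p = \<gamma> t0"
  define D where "D s = (norm (\<gamma> s - p))\<^sup>2" for s
  define D' where "D' s = 2 * ((\<gamma> s - p) \<bullet> g (\<gamma> s))" for s
  have D': "DERIV D s :> D' s" if "0 < s" for s
    unfolding D_def D'_def using that by (rule DERIV_norm_diff_squared)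
  have D'_bound: "\<bar>D' s\<bar> \<le> 2 * L * D s" for s
  proof -
    have "\<bar>D' s\<bar> \<le> 2 * (norm (\<gamma> s - p) * norm (g (\<gamma> s) - g p))"
      unfolding D'_def using Cauchy_Schwarz_ineq2[of "\<gamma> s - p" "g (\<gamma> s)"] crit
      by (simp add: p_def)
    also have "\<dots> \<le> 2 * (norm (\<gamma> s - p) * (L * norm (\<gamma> s - p)))"
      using lipschitz[of "\<gamma> s" p] by (intro mult_left_mono) auto
    finally show ?thesis by (simp add: D_def power2_eq_square mult_ac)
  qed
  have contD: "continuous_on {0..} D"
    unfolding D_def by (intro continuous_intros continuous_on_flow)
  have D0: "D t0 = 0" by (simp add: D_def p_def)
  have "D t \<le> 0"
  proof (cases "t \<le> t0")
    case True
    have "D t * exp (2 * L * t) \<le> D t0 * exp (2 * L * t0)"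
    proof (rule DERIV_nonneg_imp_increasing_open[OF True])
      show "continuous_on {t..t0} (\<lambda>s. D s * exp (2 * L * s))"
        using t by (intro continuous_intros continuous_on_subset[OF contD]) auto
      fix s assume s: "t < s" "s < t0"
      have "DERIV (\<lambda>s. D s * exp (2 * L * s)) s :> (D' s + 2 * L * D s) * exp (2 * L * s)"
        using D'[of s] s t by (auto intro!: derivative_eq_intros simp: algebra_simps)
      moreover have "0 \<le> (D' s + 2 * L * D s) * exp (2 * L * s)"
        using D'_bound[of s] by (intro mult_nonneg_nonneg) auto
      ultimately show "\<exists>y. DERIV (\<lambda>s. D s * exp (2 * L * s)) s :> y \<and> 0 \<le> y" by blast
    qed
    then show ?thesis by (simp add: D0 mult_le_0_iff)
  next
    case False
    have "D t * exp (- 2 * L * t) \<le> D t0 * exp (- 2 * L * t0)"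
    proof (rule DERIV_nonpos_imp_decreasing_open[of t0 t "\<lambda>s. D s * exp (- 2 * L * s)"])
      show "t0 \<le> t" using False by simp
      show "continuous_on {t0..t} (\<lambda>s. D s * exp (- 2 * L * s))"
        using t0 by (intro continuous_intros continuous_on_subset[OF contD]) auto
      fix s assume s: "t0 < s" "s < t"
      have "DERIV (\<lambda>s. D s * exp (- 2 * L * s)) s :> (D' s - 2 * L * D s) * exp (- 2 * L * s)"
        using D'[of s] s t0 by (auto intro!: derivative_eq_intros simp: algebra_simps)
      moreover have "(D' s - 2 * L * D s) * exp (- 2 * L * s) \<le> 0"
        using D'_bound[of s] by (intro mult_nonpos_nonneg) auto
      ultimately show "\<exists>y. DERIV (\<lambda>s. D s * exp (- 2 * L * s)) s :> y \<and> y \<le> 0" by blast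
    qed
    then show ?thesis by (simp add: D0 mult_le_0_iff)
  qed
  then show ?thesis by (simp add: D_def p_def)
qed

end

section \<open>Second-order behaviour at a nondegenerate local maximum\<close>

context lipschitz_gradient
begin

text \<open>The quotient is symmetric in \<open>u\<close> and \<open>v\<close> while its limit is
  not visibly so; this is the source of the symmetry of the Hessian. The mean value theorem is
  applied in direction \<open>u\<close> only, and \<open>g\<close> is then linearised at
  \<open>x\<close>.\<close>

lemma second_difference_tendsto:
  assumes H: "(g has_derivative H) (at x)"
  shows "((\<lambda>t. (f (x + t *\<^sub>R u + t *\<^sub>R v) - f (x + t *\<^sub>R u) - f (x + t *\<^sub>R v) + f x) / t\<^sup>2)
    \<longlongrightarrow> u \<bullet> H v) (at_right 0)"
proof (rule tendstoI)
  fix e :: real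
  assume e: "0 < e"
  define K where "K = norm u + norm v + 1"
  have K: "1 \<le> K" "norm u \<le> K" "norm v \<le> K" by (auto simp: K_def)
  \<comment> \<open>The linearisation errors at two points will add up to
    \<open>2 * e' * K\<^sup>2 = 2 * e / 3\<close>, strictly below \<open>e\<close>.\<close>
  define e' where "e' = e / (3 * K\<^sup>2)"
  have e': "0 < e'" using e K by (simp add: e'_def)
  interpret H: bounded_linear H using H by (rule has_derivative_bounded_linear)
  obtain d where d: "0 < d"
    and gH: "\<And>y. norm (y - x) < d \<Longrightarrow> norm (g y - g x - H (y - x)) \<le> e' * norm (y - x)"
    using H e' unfolding has_derivative_at_alt by blast
  let ?D = "\<lambda>t. f (x + t *\<^sub>R u + t *\<^sub>R v) - f (x + t *\<^sub>R u) - f (x + t *\<^sub>R v) + f x"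
  have "dist (?D t / t\<^sup>2) (u \<bullet> H v) < e" if t: "0 < t" "t < d / K" for t
  proof -
    have tK: "t * K < d" using t K by (simp add: field_simps)
    \<comment> \<open>Treating the difference along two parallel lines as one function yields a
      common intermediate \<open>s\<close>, which then cancels in \<open>H y - H z\<close>.\<close>
    let ?\<phi> = "\<lambda>s. f ((x + t *\<^sub>R v) + s *\<^sub>R (t *\<^sub>R u)) - f (x + s *\<^sub>R (t *\<^sub>R u))"
    have "DERIV ?\<phi> s :> g ((x + t *\<^sub>R v) + s *\<^sub>R (t *\<^sub>R u)) \<bullet> (t *\<^sub>R u)
        - g (x + s *\<^sub>R (t *\<^sub>R u)) \<bullet> (t *\<^sub>R u)" for s
      by (intro DERIV_diff DERIV_on_line)
    from MVT2[of 0 1, OF _ this] obtain s where s: "0 < s" "s < 1"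
      and eq: "?\<phi> 1 - ?\<phi> 0 = g ((x + t *\<^sub>R v) + s *\<^sub>R (t *\<^sub>R u)) \<bullet> (t *\<^sub>R u)
        - g (x + s *\<^sub>R (t *\<^sub>R u)) \<bullet> (t *\<^sub>R u)"
      by auto
    define y where "y = t *\<^sub>R v + (s * t) *\<^sub>R u"
    define z where "z = (s * t) *\<^sub>R u"
    have "s * t \<le> t" using s t by simp
    then have su: "(s * t) * norm u \<le> t * norm u" by (rule mult_right_mono) simp
    have "norm y \<le> t * norm v + (s * t) * norm u"
      unfolding y_def using norm_triangle_ineq[of "t *\<^sub>R v" "(s * t) *\<^sub>R u"] s t by simp
    also have "\<dots> \<le> t * (norm v + norm u)" using su by (simp add: distrib_left)
    also have "\<dots> \<le> t * K" using t by (intro mult_left_mono) (auto simp: K_def)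
    finally have ny: "norm y \<le> t * K" .
    have "norm z = (s * t) * norm u" unfolding z_def using s t by simp
    also have "\<dots> \<le> t * K" using su K t by (meson mult_left_mono less_imp_le order.trans)
    finally have nz: "norm z \<le> t * K" .
    have Dt: "?D t = t * ((g (x + y) - g (x + z)) \<bullet> u)"
      using eq by (simp add: y_def z_def inner_diff_left algebra_simps)
    have "norm (g (x + y) - g x - H y) \<le> e' * (t * K)"
      using gH[of "x + y"] ny tK e'
      by (auto intro: order.trans[OF _ mult_left_mono[of "norm y" "t * K" e']])
    moreover have "norm (g (x + z) - g x - H z) \<le> e' * (t * K)"
      using gH[of "x + z"] nz tK e'
      by (auto intro: order.trans[OF _ mult_left_mono[of "norm z" "t * K" e']])
    moreover have "H y - H z = t *\<^sub>R H v"
      by (simp add: y_def z_def H.add H.scaleR)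
    ultimately have err: "norm (g (x + y) - g (x + z) - t *\<^sub>R H v) \<le> 2 * e' * (t * K)"
      using norm_triangle_ineq4[of "g (x + y) - g x - H y" "g (x + z) - g x - H z"]
      by (simp add: algebra_simps)
    have "\<bar>?D t - t\<^sup>2 * (u \<bullet> H v)\<bar> = t * \<bar>(g (x + y) - g (x + z) - t *\<^sub>R H v) \<bullet> u\<bar>"
    proof -
      have "?D t - t\<^sup>2 * (u \<bullet> H v) = t * ((g (x + y) - g (x + z) - t *\<^sub>R H v) \<bullet> u)"
        unfolding Dt by (simp add: inner_diff_left inner_commute[of u] power2_eq_square algebra_simps)
      then show ?thesis using t by (simp only: abs_mult)
    qed
    also have "\<dots> \<le> t * (2 * e' * (t * K) * K)"
      using t Cauchy_Schwarz_ineq2[of "g (x + y) - g (x + z) - t *\<^sub>R H v" u]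
        mult_mono[OF err \<open>norm u \<le> K\<close>] e' K
      by (intro mult_left_mono) auto
    also have "\<dots> = t\<^sup>2 * (2 * e / 3)"
      using K by (simp add: e'_def power2_eq_square)
    also have "\<dots> < t\<^sup>2 * e" using t e by simp
    finally have "\<bar>?D t - t\<^sup>2 * (u \<bullet> H v)\<bar> < t\<^sup>2 * e" .
    moreover have "?D t - t\<^sup>2 * (u \<bullet> H v) = t\<^sup>2 * (?D t / t\<^sup>2 - u \<bullet> H v)"
      using t by (simp add: field_simps)
    ultimately have "t\<^sup>2 * \<bar>?D t / t\<^sup>2 - u \<bullet> H v\<bar> < t\<^sup>2 * e"
      by (simp only: abs_mult) simp
    then show ?thesis using t by (simp add: dist_real_def)
  qed
  moreover have "\<forall>\<^sub>F t in at_right 0. 0 < t \<and> t < d / K"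
    using d K by (intro eventually_conj eventually_at_right_less)
      (auto simp: eventually_at_right_field intro!: exI[of _ "d / K"])
  ultimately show "\<forall>\<^sub>F t in at_right 0. dist (?D t / t\<^sup>2) (u \<bullet> H v) < e"
    by (auto elim: eventually_mono)
qed

lemma derivative_gradient_symmetric:
  assumes H: "(g has_derivative H) (at x)"
  shows "u \<bullet> H v = v \<bullet> H u"
proof (rule tendsto_unique)
  show "((\<lambda>t. (f (x + t *\<^sub>R u + t *\<^sub>R v) - f (x + t *\<^sub>R u) - f (x + t *\<^sub>R v) + f x) / t\<^sup>2)
      \<longlongrightarrow> u \<bullet> H v) (at_right 0)"
    using H by (rule second_difference_tendsto)
  show "((\<lambda>t. (f (x + t *\<^sub>R u + t *\<^sub>R v) - f (x + t *\<^sub>R u) - f (x + t *\<^sub>R v) + f x) / t\<^sup>2)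
      \<longlongrightarrow> v \<bullet> H u) (at_right 0)"
    using second_difference_tendsto[OF H, of v u] by (simp add: algebra_simps)
qed simp

lemma gradient_zero_at_local_max:
  assumes "0 < r" and "\<And>y. y \<in> ball x r \<Longrightarrow> f y \<le> f x"
  shows "g x = 0"
proof -
  have "(\<lambda>h. h \<bullet> g x) = (\<lambda>h. 0)"
    using gderiv[of x] assms unfolding gderiv_def
    by (intro differential_zero_maxmin[of x "ball x r" f]) auto
  then have "g x \<bullet> g x = 0" by metis
  then show ?thesis by simp
qed

text \<open>A direction with \<open>v \<bullet> H v > 0\<close> would give \<open>g\<close> a
  positive component along \<open>v\<close> just beyond \<open>x\<close>, and by the mean value
  theorem \<open>f\<close> would exceed its maximum there.\<close>

lemma derivative_gradient_nonpos_at_local_max: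
  assumes H: "(g has_derivative H) (at x)"
    and r: "0 < r" and max: "\<And>y. y \<in> ball x r \<Longrightarrow> f y \<le> f x"
  shows "v \<bullet> H v \<le> 0"
proof (rule ccontr)
  assume "\<not> v \<bullet> H v \<le> 0"
  then have pos: "0 < v \<bullet> H v" by simp
  interpret H: bounded_linear H using H by (rule has_derivative_bounded_linear)
  have v: "v \<noteq> 0" using pos by auto
  define e where "e = v \<bullet> H v / (2 * (norm v)\<^sup>2)"
  have e: "0 < e" using pos v by (simp add: e_def)
  obtain d where d: "0 < d"
    and gH: "\<And>y. norm (y - x) < d \<Longrightarrow> norm (g y - g x - H (y - x)) \<le> e * norm (y - x)"
    using H e unfolding has_derivative_at_alt by blast
  define t where "t = min d r / (2 * norm v)"
  have t: "0 < t" "t * norm v < d" "t * norm v < r"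
    using d r v by (auto simp: t_def)
  have g0: "g x = 0" using r max by (rule gradient_zero_at_local_max)
  obtain s where s: "0 < s" "s < t"
    and eq: "f (x + t *\<^sub>R v) - f (x + 0 *\<^sub>R v) = (t - 0) * (g (x + s *\<^sub>R v) \<bullet> v)"
    using MVT2[of 0 t "\<lambda>s. f (x + s *\<^sub>R v)", OF _ DERIV_on_line] t by auto
  have "s * norm v \<le> t * norm v" using s by (intro mult_right_mono) auto
  then have "norm (g (x + s *\<^sub>R v) - s *\<^sub>R H v) \<le> e * (s * norm v)"
    using gH[of "x + s *\<^sub>R v"] s t by (simp add: g0 H.scaleR)
  then have "\<bar>(g (x + s *\<^sub>R v) - s *\<^sub>R H v) \<bullet> v\<bar> \<le> e * (s * norm v) * norm v"
    by (meson Cauchy_Schwarz_ineq2 mult_right_mono norm_ge_zero order.trans)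
  also have "\<dots> = s * (v \<bullet> H v) / 2" using v by (simp add: e_def power2_eq_square)
  finally have "\<bar>(g (x + s *\<^sub>R v) - s *\<^sub>R H v) \<bullet> v\<bar> \<le> s * (v \<bullet> H v) / 2" .
  from abs_le_D2[OF this] have "s * (v \<bullet> H v) / 2 \<le> g (x + s *\<^sub>R v) \<bullet> v"
    unfolding inner_diff_left by (simp add: inner_commute[of v])
  moreover have "0 < s * (v \<bullet> H v) / 2" using s pos by simp
  ultimately have "0 < t * (g (x + s *\<^sub>R v) \<bullet> v)" using t by simp
  then have "f x < f (x + t *\<^sub>R v)" using eq by simp
  moreover have "f (x + t *\<^sub>R v) \<le> f x"
    using t by (intro max) (simp add: dist_norm)
  ultimately show False by simp
qed

lemma derivative_gradient_negative_definite_at_local_max: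
  assumes H: "(g has_derivative H) (at x)" and inj: "\<And>v. H v = 0 \<Longrightarrow> v = 0"
    and r: "0 < r" and max: "\<And>y. y \<in> ball x r \<Longrightarrow> f y \<le> f x"
  obtains c where "0 < c" and "\<And>v. v \<bullet> H v \<le> - c * (norm v)\<^sup>2"
proof -
  interpret H: bounded_linear H using H by (rule has_derivative_bounded_linear)
  have nonpos: "v \<bullet> H v \<le> 0" for v
    using H r max by (rule derivative_gradient_nonpos_at_local_max)
  have neg: "v \<bullet> H v < 0" if "v \<noteq> 0" for v
  proof (rule ccontr)
    assume "\<not> v \<bullet> H v < 0"
    then have zero: "v \<bullet> H v = 0" using nonpos[of v] by simp
    txt \<open>A zero \<open>v\<close> of a nonpositive quadratic form maximises it, so the form's gradient at \<open>v\<close>,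
      which is \<open>2 * H v\<close> by symmetry, vanishes.\<close>
    have "2 * (w \<bullet> H v) + t * (w \<bullet> H w) \<le> 0" if "0 < t" for w t
    proof -
      have "t * (2 * (w \<bullet> H v) + t * (w \<bullet> H w)) = (v + t *\<^sub>R w) \<bullet> H (v + t *\<^sub>R w)"
        using derivative_gradient_symmetric[OF H, of v w] zero
        by (simp add: H.add H.scaleR inner_add_left inner_add_right algebra_simps)
      also have "\<dots> \<le> 0" by (rule nonpos)
      finally show ?thesis using that by (simp add: mult_le_0_iff)
    qed
    then have ev: "\<forall>\<^sub>F t in at_right 0. 2 * (w \<bullet> H v) + t * (w \<bullet> H w) \<le> 0" for w
      by (simp add: eventually_at_filter)
    have lim: "((\<lambda>t. 2 * (w \<bullet> H v) + t * (w \<bullet> H w)) \<longlongrightarrow> 2 * (w \<bullet> H v) + 0 * (w \<bullet> H w)) (at_right 0)"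
      for w by (intro tendsto_intros)
    have "2 * (w \<bullet> H v) + 0 * (w \<bullet> H w) \<le> 0" for w
      by (rule tendsto_upperbound[OF lim ev]) simp
    \<comment> \<open>In the direction \<open>H v\<close> itself the linear term is a squared
      norm.\<close>
    from this[of "H v"] have "H v = 0" by (simp flip: power2_norm_eq_inner)
    then show False using inj that by blast
  qed
  \<comment> \<open>Compactness of the unit sphere makes the negativity uniform, and homogeneity
    carries the constant to all vectors. The vector \<open>b\<close> shows that the sphere is
    nonempty.\<close>
  obtain b :: "real ^ 'n" where "norm b = 1" using vector_choose_size[of 1] by auto
  then have "sphere (0 :: real ^ 'n) 1 \<noteq> {}" by auto
  moreover have "continuous_on (sphere 0 1) (\<lambda>v. v \<bullet> H v)"
    by (intro continuous_intros H.continuous_on)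
  ultimately obtain w where w: "norm w = 1" and sup: "\<And>v. norm v = 1 \<Longrightarrow> v \<bullet> H v \<le> w \<bullet> H w"
    using continuous_attains_sup[of "sphere (0 :: real ^ 'n) 1" "\<lambda>v. v \<bullet> H v"] by auto
  show thesis
  proof
    have "w \<noteq> 0" using w by auto
    then show "0 < - (w \<bullet> H w)" using neg[of w] by simp
    show "v \<bullet> H v \<le> - (- (w \<bullet> H w)) * (norm v)\<^sup>2" for v
    proof (cases "v = 0")
      case False
      define u where "u = v /\<^sub>R norm v"
      have "v = norm v *\<^sub>R u" using False by (simp add: u_def)
      from arg_cong[OF this, of "\<lambda>v. v \<bullet> H v"] have "v \<bullet> H v = (u \<bullet> H u) * (norm v)\<^sup>2"
        by (simp add: H.scaleR power2_eq_square)
      moreover have "u \<bullet> H u \<le> w \<bullet> H w" using False by (intro sup) (simp add: u_def)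
      ultimately show ?thesis by (simp add: mult_right_mono)
    qed simp
  qed
qed

text \<open>Half of the definiteness constant pays for the linearisation error of \<open>g\<close>.
  The resulting inequality is all that growth and absorption near the mode use about second
  derivatives.\<close>

lemma gradient_points_to_nondegenerate_local_max:
  assumes H: "(g has_derivative H) (at x)" and inj: "\<And>v. H v = 0 \<Longrightarrow> v = 0"
    and r: "0 < r" and max: "\<And>y. y \<in> ball x r \<Longrightarrow> f y \<le> f x"
  obtains c d where "0 < c" and "0 < d"
    and "\<And>y. y \<in> cball x d \<Longrightarrow> c * (norm (x - y))\<^sup>2 \<le> g y \<bullet> (x - y)"
proof -
  obtain c where c: "0 < c" and neg: "\<And>v. v \<bullet> H v \<le> - c * (norm v)\<^sup>2"
    using derivative_gradient_negative_definite_at_local_max[OF H inj r max] by blast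
  obtain d where d: "0 < d"
    and gH: "\<And>y. norm (y - x) < d \<Longrightarrow> norm (g y - g x - H (y - x)) \<le> c / 2 * norm (y - x)"
    using H c unfolding has_derivative_at_alt by (metis half_gt_zero)
  have g0: "g x = 0" using r max by (rule gradient_zero_at_local_max)
  show thesis
  proof
    show "0 < c / 2" "0 < d / 2" using c d by auto
    fix y assume "y \<in> cball x (d / 2)"
    then have y: "norm (y - x) < d" using d by (simp add: dist_norm norm_minus_commute)
    define w where "w = y - x"
    have "\<bar>(g y - H w) \<bullet> w\<bar> \<le> c / 2 * norm w * norm w"
      using gH[OF y] unfolding w_def g0 diff_zero
      by (meson Cauchy_Schwarz_ineq2 mult_right_mono norm_ge_zero order.trans)
    from abs_le_D1[OF this] have "g y \<bullet> w \<le> w \<bullet> H w + c / 2 * (norm w)\<^sup>2"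
      unfolding inner_diff_left by (simp add: inner_commute[of w] power2_eq_square)
    also have "\<dots> \<le> - (c / 2) * (norm w)\<^sup>2" using neg[of w] by (simp add: algebra_simps)
    finally have "c / 2 * (norm w)\<^sup>2 \<le> g y \<bullet> (- w)" by simp
    then show "c / 2 * (norm (x - y))\<^sup>2 \<le> g y \<bullet> (x - y)"
      by (simp add: w_def norm_minus_commute)
  qed
qed

text \<open>At parameter \<open>u\<close> of the segment the directional derivative is at least
  \<open>c * (1 - u)\<close> times the squared length; integrating gives
  \<open>s - s\<^sup>2 / 2\<close>, which is at least \<open>s / 2\<close>. The case
  \<open>s = 1\<close> is the quadratic lower bound for \<open>f x - f y\<close>, a small
  \<open>s\<close> measures the gain of one step.\<close>

lemma growth_towards_local_max:
  assumes grad: "\<And>y. y \<in> cball x d \<Longrightarrow> c * (norm (x - y))\<^sup>2 \<le> g y \<bullet> (x - y)"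
    and c: "0 < c" and y: "y \<in> cball x d" and s: "0 \<le> s" "s \<le> 1"
  shows "f y + c / 2 * s * (norm (x - y))\<^sup>2 \<le> f (y + s *\<^sub>R (x - y))"
proof -
  let ?N = "(norm (x - y))\<^sup>2"
  let ?\<psi> = "\<lambda>s. f (y + s *\<^sub>R (x - y)) - c * ?N * (s - s\<^sup>2 / 2)"
  have DERIV_\<psi>: "DERIV ?\<psi> u :> g (y + u *\<^sub>R (x - y)) \<bullet> (x - y) - c * ?N * (1 - u)" for u
    by (intro DERIV_diff DERIV_on_line) (auto intro!: derivative_eq_intros)
  have "?\<psi> 0 \<le> ?\<psi> s"
  proof (rule DERIV_nonneg_imp_increasing_open[of 0 s ?\<psi>])
    show "continuous_on {0..s} ?\<psi>"
      using DERIV_\<psi> by (meson DERIV_isCont continuous_at_imp_continuous_on)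
    fix u assume u: "0 < u" "u < s"
    define z where "z = y + u *\<^sub>R (x - y)"
    have xz: "x - z = (1 - u) *\<^sub>R (x - y)" by (simp add: z_def algebra_simps)
    have "norm (x - z) \<le> norm (x - y)"
      unfolding xz using u s by (simp add: mult_left_le_one_le)
    then have "z \<in> cball x d" using y by (simp add: dist_norm)
    \<comment> \<open>Both sides carry a factor \<open>1 - u\<close> because \<open>x - z\<close> is
      a multiple of \<open>x - y\<close>; it is positive as \<open>u < s \<le> 1\<close> and
      cancels.\<close>
    from grad[OF this] have "(1 - u) * (c * (1 - u) * ?N) \<le> (1 - u) * (g z \<bullet> (x - y))"
      unfolding xz using u s by (simp add: power_mult_distrib power2_eq_square mult_ac)
    then have "c * (1 - u) * ?N \<le> g z \<bullet> (x - y)" using u s by simp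
    then have "0 \<le> g (y + u *\<^sub>R (x - y)) \<bullet> (x - y) - c * ?N * (1 - u)"
      by (simp add: z_def mult_ac)
    then show "\<exists>D. DERIV ?\<psi> u :> D \<and> 0 \<le> D" using DERIV_\<psi> by blast
  qed (rule s)
  moreover have "c / 2 * s * ?N \<le> c * ?N * (s - s\<^sup>2 / 2)"
  proof -
    have "s / 2 \<le> s - s\<^sup>2 / 2" using s by (simp add: power2_eq_square mult_left_le)
    then have "c * ?N * (s / 2) \<le> c * ?N * (s - s\<^sup>2 / 2)" using c by (intro mult_left_mono) auto
    then show ?thesis by (simp add: mult_ac)
  qed
  ultimately show ?thesis by simp
qed

end

section \<open>Steps and runs of the algorithm for continuous functions\<close>

lemma ball_max_attained:
  fixes f :: "real ^ 'n \<Rightarrow> real"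
  assumes "continuous_on UNIV f" and "0 \<le> \<epsilon>"
  obtains y where "y \<in> cball q \<epsilon>" "f y = ball_max f \<epsilon> q" "\<And>z. z \<in> cball q \<epsilon> \<Longrightarrow> f z \<le> f y"
proof -
  have "cball q \<epsilon> \<noteq> {}" using assms(2) by simp
  then obtain y where y: "y \<in> cball q \<epsilon>" "\<And>z. z \<in> cball q \<epsilon> \<Longrightarrow> f z \<le> f y"
    using continuous_attains_sup[of "cball q \<epsilon>" f] continuous_on_subset[OF assms(1)] by auto
  moreover have "ball_max f \<epsilon> q = f y"
    unfolding ball_max_def using y by (intro Greatest_equality) auto
  ultimately show thesis using that by metis
qed

text \<open>A maximiser on the ball lies on the target level set, so the projection is at most as
  far away: it stays in the ball and is a maximiser there itself. The quantitative estimates see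
  steps only through these two facts.\<close>

lemma algorithm_stepD:
  fixes f :: "real ^ 'n \<Rightarrow> real"
  assumes cont: "continuous_on UNIV f" and \<epsilon>: "0 \<le> \<epsilon>" and step: "algorithm_step f \<epsilon> q q'"
  shows "norm (q' - q) \<le> \<epsilon>" and "\<And>z. z \<in> cball q \<epsilon> \<Longrightarrow> f z \<le> f q'"
proof -
  obtain y where y: "y \<in> cball q \<epsilon>" "f y = ball_max f \<epsilon> q" "\<And>z. z \<in> cball q \<epsilon> \<Longrightarrow> f z \<le> f y"
    using ball_max_attained[OF cont \<epsilon>] by blast
  have q': "f q' = ball_max f \<epsilon> q" "norm (q - q') \<le> norm (q - y)"
    using step y(2)
    by (auto simp: algorithm_step_def is_projection_def is_arg_min_linorder level_set_def)
  show "norm (q' - q) \<le> \<epsilon>"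
    using q' y(1) by (simp add: dist_norm norm_minus_commute)
  show "f z \<le> f q'" if "z \<in> cball q \<epsilon>" for z
    using y that q' by simp
qed

text \<open>Here \<open>q\<close> lies on its own target level set, at distance 0, so it is the only
  nearest point.\<close>

lemma algorithm_step_at_maximum:
  fixes f :: "real ^ 'n \<Rightarrow> real"
  assumes \<epsilon>: "0 \<le> \<epsilon>" and max: "\<And>z. z \<in> cball q \<epsilon> \<Longrightarrow> f z \<le> f q"
  shows "algorithm_step f \<epsilon> q q' \<longleftrightarrow> q' = q"
proof -
  have "f q = ball_max f \<epsilon> q"
    unfolding ball_max_def by (rule Greatest_equality[symmetric]) (use max \<epsilon> in auto)
  then have "q \<in> level_set f (ball_max f \<epsilon> q)" by (simp add: level_set_def)
  then show ?thesis
    by (auto simp: algorithm_step_def is_projection_def is_arg_min_linorder)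
qed

lemma algorithm_step_exists:
  fixes f :: "real ^ 'n \<Rightarrow> real"
  assumes cont: "continuous_on UNIV f" and \<epsilon>: "0 \<le> \<epsilon>"
  shows "\<exists>q'. algorithm_step f \<epsilon> q q'"
proof -
  let ?A = "level_set f (ball_max f \<epsilon> q)"
  obtain y where "f y = ball_max f \<epsilon> q"
    using ball_max_attained[OF cont \<epsilon>] by blast
  then have "?A \<noteq> {}" by (auto simp: level_set_def)
  moreover have "closed ?A"
    using continuous_closed_preimage[OF cont closed_UNIV closed_singleton[of "ball_max f \<epsilon> q"]]
    by (simp add: level_set_def vimage_def)
  ultimately obtain p where "p \<in> ?A" "\<And>z. z \<in> ?A \<Longrightarrow> dist q p \<le> dist q z"
    using distance_attains_inf[of ?A q] by blast
  then have "algorithm_step f \<epsilon> q p"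
    by (auto simp: algorithm_step_def is_projection_def is_arg_min_linorder dist_norm)
  then show ?thesis ..
qed

text \<open>A step that does not move certifies that its point maximises \<open>f\<close> on the ball, so further
  steps would not move either: stopping can be ignored.\<close>

lemma algorithm_run_iff:
  fixes f :: "real ^ 'n \<Rightarrow> real"
  assumes cont: "continuous_on UNIV f" and \<epsilon>: "0 \<le> \<epsilon>"
  shows "algorithm_run f \<epsilon> x q \<longleftrightarrow> q 0 = x \<and> (\<forall>k. algorithm_step f \<epsilon> (q k) (q (Suc k)))"
proof
  assume run: "algorithm_run f \<epsilon> x q"
  then have run_stopped: "stopped q k \<Longrightarrow> q (Suc k) = q k"
    and run_step: "\<not> stopped q k \<Longrightarrow> algorithm_step f \<epsilon> (q k) (q (Suc k))" for k
    unfolding algorithm_run_def by metis+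
  have "(stopped q k \<longrightarrow> algorithm_step f \<epsilon> (q k) (q k)) \<and> algorithm_step f \<epsilon> (q k) (q (Suc k))"
    for k
  proof (induction k)
    case 0
    have "\<not> stopped q 0" by (simp add: stopped_def)
    then show ?case using run_step by blast
  next
    case (Suc k)
    \<comment> \<open>A run stopped at \<open>Suc k\<close> made no move from \<open>k\<close>, so
      by the induction hypothesis the trivial step is admissible at the current point.\<close>
    have "algorithm_step f \<epsilon> (q (Suc k)) (q (Suc k))" if "stopped q (Suc k)"
    proof -
      have "q (Suc k) = q k"
        using that run_stopped[of k] by (auto simp: stopped_def less_Suc_eq)
      then show ?thesis using Suc by simp
    qed
    then show ?case using run_stopped[of "Suc k"] run_step[of "Suc k"] by metis
  qed
  then show "q 0 = x \<and> (\<forall>k. algorithm_step f \<epsilon> (q k) (q (Suc k)))"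
    using run by (simp add: algorithm_run_def)
next
  assume q: "q 0 = x \<and> (\<forall>k. algorithm_step f \<epsilon> (q k) (q (Suc k)))"
  have "q (Suc k) = q k" if k: "stopped q k" for k
  proof -
    obtain j where j: "j < k" "q (Suc j) = q j" using k by (auto simp: stopped_def)
    have max: "f z \<le> f (q j)" if "z \<in> cball (q j) \<epsilon>" for z
      using algorithm_stepD(2)[OF cont \<epsilon>, of "q j" "q (Suc j)" z] q that
      unfolding j(2) by (metis j(2))
    have const: "q (j + i) = q j" for i
    proof (induction i)
      case (Suc i)
      then show ?case
        using algorithm_step_at_maximum[where f = f and q = "q j", OF \<epsilon> max] q by (metis add_Suc_right)
    qed simp
    show ?thesis using const[of "k - j"] const[of "Suc k - j"] j by simp
  qed
  then show "algorithm_run f \<epsilon> x q" using q by (simp add: algorithm_run_def)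
qed

lemma algorithm_run_exists:
  fixes f :: "real ^ 'n \<Rightarrow> real"
  assumes cont: "continuous_on UNIV f" and \<epsilon>: "0 \<le> \<epsilon>"
  shows "\<exists>q. algorithm_run f \<epsilon> x q"
proof -
  have "\<exists>q. \<forall>k. (k = 0 \<longrightarrow> q k = x) \<and> algorithm_step f \<epsilon> (q k) (q (Suc k))"
    by (rule dependent_nat_choice) (use algorithm_step_exists[OF cont \<epsilon>] in auto)
  then show ?thesis unfolding algorithm_run_iff[OF cont \<epsilon>] by blast
qed

section \<open>Steps against the gradient direction; absorption by a maximum\<close>

context lipschitz_gradient
begin

text \<open>The comparison of values forces the component of the step along the unit gradient to be
  at least \<open>\<epsilon> - 2 * L * \<epsilon>\<^sup>2 / m\<close>. A vector of length at most
  \<epsilon> with such a component lies in a thin cap of the ball, whose width is of the order of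
  the square root of \<epsilon> times its depth; hence the exponent 3/2.\<close>

lemma algorithm_step_near_gradient_step:
  assumes \<epsilon>: "0 < \<epsilon>" and step: "algorithm_step f \<epsilon> q q'" and m: "0 < m" "m \<le> norm (g q)"
  shows "norm (q' - q - (\<epsilon> / norm (g q)) *\<^sub>R g q) \<le> \<epsilon> * sqrt (4 * L * \<epsilon> / m)"
proof -
  define N where "N = norm (g q)"
  define u where "u = g q /\<^sub>R N"
  have N: "0 < N" "m \<le> N" using m by (auto simp: N_def)
  have nu: "norm u = 1" using N by (simp add: u_def N_def)
  have gu: "g q = N *\<^sub>R u" using N by (simp add: u_def)
  let ?v = "q' - q"
  have v: "norm ?v \<le> \<epsilon>" and max: "\<And>z. z \<in> cball q \<epsilon> \<Longrightarrow> f z \<le> f q'"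
    using algorithm_stepD[OF continuous_on_f _ step] \<epsilon> by auto
  txt \<open>Compare \<open>f\<close> at the new point with its value one step of length \<open>\<epsilon>\<close> along the gradient.\<close>
  have "f (q + \<epsilon> *\<^sub>R u) \<le> f q'"
    using nu \<epsilon> by (intro max) (simp add: dist_norm)
  moreover have "f q + N * \<epsilon> - L * \<epsilon>\<^sup>2 \<le> f (q + \<epsilon> *\<^sub>R u)"
  proof -
    have *: "g q \<bullet> (\<epsilon> *\<^sub>R u) = N * \<epsilon>" "(norm (\<epsilon> *\<^sub>R u))\<^sup>2 = \<epsilon>\<^sup>2"
      using nu by (simp_all add: gu power_mult_distrib norm_eq_1[symmetric] flip: power2_norm_eq_inner)
    show ?thesis using first_order_expansion[of q "\<epsilon> *\<^sub>R u"] unfolding * by linarith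
  qed
  moreover have "f q' \<le> f q + N * (u \<bullet> ?v) + L * \<epsilon>\<^sup>2"
  proof -
    have "L * (norm ?v)\<^sup>2 \<le> L * \<epsilon>\<^sup>2" using v L_pos by (simp add: power_mono)
    moreover have "g q \<bullet> ?v = N * (u \<bullet> ?v)" by (simp add: gu)
    ultimately show ?thesis using first_order_expansion[of q ?v] by simp
  qed
  ultimately have "N * \<epsilon> - 2 * (L * \<epsilon>\<^sup>2) \<le> N * (u \<bullet> ?v)" by linarith
  then have "N * (\<epsilon> - u \<bullet> ?v) \<le> 2 * L * \<epsilon>\<^sup>2" by (simp add: algebra_simps)
  moreover have "m * (\<epsilon> - u \<bullet> ?v) \<le> N * (\<epsilon> - u \<bullet> ?v)"
  proof (rule mult_right_mono[OF N(2)])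
    show "0 \<le> \<epsilon> - u \<bullet> ?v"
      using norm_cauchy_schwarz[of u ?v] nu v by simp
  qed
  ultimately have key: "\<epsilon> - u \<bullet> ?v \<le> 2 * L * \<epsilon>\<^sup>2 / m"
    using m by (simp add: field_simps)
  have sq: "(norm (w - \<epsilon> *\<^sub>R u))\<^sup>2 = (norm w)\<^sup>2 - 2 * \<epsilon> * (u \<bullet> w) + \<epsilon>\<^sup>2" for w
    using nu unfolding power2_norm_eq_inner norm_eq_1
    by (simp add: inner_diff_left inner_diff_right inner_commute[of w u] power2_eq_square algebra_simps)
  have "(norm (?v - \<epsilon> *\<^sub>R u))\<^sup>2 = (norm ?v)\<^sup>2 - 2 * \<epsilon> * (u \<bullet> ?v) + \<epsilon>\<^sup>2"
    by (rule sq)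
  also have "\<dots> \<le> 2 * \<epsilon> * (\<epsilon> - u \<bullet> ?v)"
  proof -
    have "(norm ?v)\<^sup>2 \<le> \<epsilon>\<^sup>2" using v by (rule power_mono) simp
    moreover have "2 * \<epsilon> * (\<epsilon> - b) = 2 * \<epsilon>\<^sup>2 - 2 * \<epsilon> * b" for b
      by (simp add: power2_eq_square right_diff_distrib)
    ultimately show ?thesis by simp
  qed
  also have "\<dots> \<le> 2 * \<epsilon> * (2 * L * \<epsilon>\<^sup>2 / m)" using key \<epsilon> by (intro mult_left_mono) auto
  also have "\<dots> = (\<epsilon> * sqrt (4 * L * \<epsilon> / m))\<^sup>2"
  proof -
    have "(sqrt (4 * L * \<epsilon> / m))\<^sup>2 = 4 * L * \<epsilon> / m" using \<epsilon> L_pos m by simp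
    then show ?thesis by (simp only: power_mult_distrib) (simp add: power2_eq_square)
  qed
  finally have "norm (?v - \<epsilon> *\<^sub>R u) \<le> \<epsilon> * sqrt (4 * L * \<epsilon> / m)"
    by (rule power2_le_imp_le) (use \<epsilon> L_pos m in simp)
  then show ?thesis by (simp add: u_def N_def divide_inverse_commute mult.commute)
qed


text \<open>The level in \<open>start\<close> comes from the quadratic lower bound at radius
  \<open>\<eta> / 2\<close>: a point of the \<eta>-ball with at least this value is within
  \<open>\<eta> / 2\<close> of \<open>z\<close>. As \<open>f\<close> never decreases along the run
  and a step of length at most \<open>\<eta> / 2\<close> cannot leave the \<eta>-ball from there,
  both conditions persist.\<close>

lemma algorithm_absorbed_by_nondegenerate_max:
  assumes grad: "\<And>y. y \<in> cball z d \<Longrightarrow> c * (norm (z - y))\<^sup>2 \<le> g y \<bullet> (z - y)"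
    and c: "0 < c" and \<eta>: "0 < \<eta>" "\<eta> \<le> d" and \<epsilon>: "0 < \<epsilon>" "\<epsilon> \<le> \<eta> / 2"
    and steps: "\<And>k. algorithm_step f \<epsilon> (q k) (q (Suc k))"
    and start: "norm (z - q N) \<le> \<eta>" "f z - c / 2 * (\<eta> / 2)\<^sup>2 \<le> f (q N)"
  shows "N \<le> k \<Longrightarrow> norm (z - q k) \<le> \<eta> / 2" and "\<exists>k. q k = z"
proof -
  have growth: "f y + c / 2 * s * (norm (z - y))\<^sup>2 \<le> f (y + s *\<^sub>R (z - y))"
    if "norm (z - y) \<le> \<eta>" "0 \<le> s" "s \<le> 1" for y s
    using that \<eta> by (intro growth_towards_local_max[where d = d] grad c) (auto simp: dist_norm)
  have quad: "f y + c / 2 * (norm (z - y))\<^sup>2 \<le> f z" if "norm (z - y) \<le> \<eta>" for y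
    using growth[OF that, of 1] by simp
  have near: "norm (z - y) \<le> \<eta> / 2"
    if "norm (z - y) \<le> \<eta>" "f z - c / 2 * (\<eta> / 2)\<^sup>2 \<le> f y" for y
  proof -
    have "c / 2 * (norm (z - y))\<^sup>2 \<le> c / 2 * (\<eta> / 2)\<^sup>2" using quad[OF that(1)] that(2) by linarith
    then have "(norm (z - y))\<^sup>2 \<le> (\<eta> / 2)\<^sup>2" using c by simp
    then show ?thesis by (rule power2_le_imp_le) (use \<eta> in simp)
  qed
  note stepD = algorithm_stepD[OF continuous_on_f less_imp_le[OF \<epsilon>(1)] steps]
  have near_next: "norm (z - q (Suc k)) \<le> norm (z - q k) + \<epsilon>" for k
    using norm_triangle_ineq4[of "z - q k" "q (Suc k) - q k"] stepD(1)[of k] by simp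
  have mono: "f (q k) \<le> f (q (Suc k))" for k using stepD(2)[of "q k" k] \<epsilon> by simp
  have inv: "norm (z - q (N + j)) \<le> \<eta> / 2 \<and> f (q N) \<le> f (q (N + j))" for j
  proof (induction j)
    case 0
    then show ?case using near[OF start] by simp
  next
    case (Suc j)
    have "f (q N) \<le> f (q (Suc (N + j)))" using Suc mono[of "N + j"] by linarith
    moreover have "norm (z - q (Suc (N + j))) \<le> \<eta>" using Suc near_next[of "N + j"] \<epsilon> by linarith
    ultimately show ?case using near start(2) by force
  qed
  show "norm (z - q k) \<le> \<eta> / 2" if "N \<le> k" for k
    using inv[of "k - N"] that by simp
  show "\<exists>k. q k = z"
  proof (rule ccontr)
    assume never: "\<nexists>k. q k = z"
    \<comment> \<open>If \<open>z\<close> were within reach, the next point would have a value of at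
      least \<open>f z\<close>, which on the \<eta>-ball only \<open>z\<close> has.\<close>
    have far: "\<epsilon> < norm (z - q (N + j))" for j
    proof (rule ccontr)
      assume "\<not> \<epsilon> < norm (z - q (N + j))"
      then have "z \<in> cball (q (N + j)) \<epsilon>" by (simp add: dist_norm norm_minus_commute)
      then have "f z \<le> f (q (Suc (N + j)))" using stepD(2) by blast
      moreover have "norm (z - q (Suc (N + j))) \<le> \<eta>"
        using inv[of "Suc j"] \<eta> by simp
      ultimately have "c / 2 * (norm (z - q (Suc (N + j))))\<^sup>2 \<le> 0" using quad by force
      then have "q (Suc (N + j)) = z" using c by (simp add: mult_le_0_iff)
      then show False using never by blast
    qed
    \<comment> \<open>Compare with the point at distance \<epsilon> towards \<open>z\<close>: its
      gain is at least \<open>c / 2 * \<epsilon> * norm (z - q (N + j))\<close>, more than claimed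
      by \<open>far\<close>.\<close>
    have increase: "f (q (N + j)) + c / 2 * \<epsilon>\<^sup>2 \<le> f (q (Suc (N + j)))" for j
    proof -
      let ?y = "q (N + j)"
      define s where "s = \<epsilon> / norm (z - ?y)"
      have "0 < norm (z - ?y)" using far[of j] \<epsilon> by linarith
      then have s: "0 \<le> s" "s \<le> 1" "s * norm (z - ?y) = \<epsilon>"
        using far[of j] \<epsilon> by (simp_all add: s_def divide_le_eq)
      have "\<epsilon>\<^sup>2 \<le> s * (norm (z - ?y))\<^sup>2"
        using far[of j] \<epsilon> s(3) by (simp add: power2_eq_square flip: mult.assoc)
      then have "c / 2 * \<epsilon>\<^sup>2 \<le> c / 2 * s * (norm (z - ?y))\<^sup>2" using c by simp
      moreover have "f ?y + c / 2 * s * (norm (z - ?y))\<^sup>2 \<le> f (?y + s *\<^sub>R (z - ?y))"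
        using inv[of j] \<eta> s by (intro growth) auto
      moreover have "f (?y + s *\<^sub>R (z - ?y)) \<le> f (q (Suc (N + j)))"
        using s by (intro stepD(2)) (simp add: dist_norm)
      ultimately show ?thesis by linarith
    qed
    have climb: "f (q N) + real j * (c / 2 * \<epsilon>\<^sup>2) \<le> f (q (N + j))" for j
    proof (induction j)
      case (Suc j)
      then show ?case using increase[of j] by (simp add: algebra_simps add_divide_distrib)
    qed simp
    have "0 < c / 2 * \<epsilon>\<^sup>2" using c \<epsilon> by simp
    then obtain j where "f z - f (q N) < real j * (c / 2 * \<epsilon>\<^sup>2)"
      using reals_Archimedean3 by blast
    moreover have "f (q (N + j)) + c / 2 * (norm (z - q (N + j)))\<^sup>2 \<le> f z"
      using inv[of j] \<eta> by (intro quad) auto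
    moreover have "0 \<le> c / 2 * (norm (z - q (N + j)))\<^sup>2" using c by simp
    ultimately show False using climb[of j] by linarith
  qed
qed

end

section \<open>Tracking the flow line\<close>

context lipschitz_gradient_flow
begin

text \<open>\<open>w\<close> bounds the relative error of a step against the Euler step. The Euler
  error of the flow, of order \<open>h\<^sup>2\<close>, fits under the same bound because
  \<open>L * h \<le> w\<^sup>2 / 4 \<le> w\<close>, hence the factor 2. The factor
  \<open>1 + L * h\<close> accounts for the gap between the gradients at \<open>q\<close> and on the
  flow line.\<close>

lemma algorithm_step_flow_error:
  assumes \<epsilon>: "0 < \<epsilon>" and step: "algorithm_step f \<epsilon> q q'" and t: "0 \<le> t"
    and m: "0 < m" "m \<le> norm (g q)"
    and w: "w = sqrt (4 * L * \<epsilon> / m)" "w \<le> 1" and h: "h = \<epsilon> / norm (g q)"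
  shows "norm (q' - \<gamma> (t + h)) \<le> (1 + L * h) * norm (q - \<gamma> t) + 2 * w * G * h"
proof -
  have "0 < norm (g q)" using m by linarith
  then have h_pos: "0 < h" and \<epsilon>h: "\<epsilon> = h * norm (g q)" using \<epsilon> by (auto simp: h)
  have w_nonneg: "0 \<le> w" and w_sq: "w\<^sup>2 = 4 * L * \<epsilon> / m" using \<epsilon> m L_pos by (auto simp: w)
  have "norm (q' - q - h *\<^sub>R g q) \<le> \<epsilon> * w"
    unfolding h w(1) using \<epsilon> step m by (rule algorithm_step_near_gradient_step)
  also have "\<dots> \<le> (h * G) * w"
    unfolding \<epsilon>h using h_pos bounded[of q] w_nonneg by (intro mult_right_mono) auto
  finally have step_err: "norm (q' - q - h *\<^sub>R g q) \<le> w * G * h" by (simp add: mult_ac)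
  have "h * m \<le> \<epsilon>" unfolding \<epsilon>h using m h_pos by simp
  then have "L * h \<le> L * (\<epsilon> / m)" using m L_pos by (simp add: field_simps)
  also have "\<dots> = w\<^sup>2 / 4" by (simp add: w_sq)
  also have "\<dots> \<le> w" using w_nonneg w(2) by (simp add: power2_eq_square) (smt (verit) mult_left_le)
  finally have "(L * h) * (G * h) \<le> w * (G * h)"
    using G_pos h_pos by (intro mult_right_mono) auto
  then have flow_err: "norm (\<gamma> (t + h) - \<gamma> t - h *\<^sub>R g (\<gamma> t)) \<le> w * G * h"
    using flow_euler_error[OF t, of h] h_pos by (simp add: power2_eq_square mult_ac)
  have "norm (h *\<^sub>R (g q - g (\<gamma> t))) \<le> h * (L * norm (q - \<gamma> t))"
    using lipschitz[of q "\<gamma> t"] h_pos by simp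
  moreover have "q' - \<gamma> (t + h) = (q' - q - h *\<^sub>R g q) + (q - \<gamma> t) + h *\<^sub>R (g q - g (\<gamma> t))
      - (\<gamma> (t + h) - \<gamma> t - h *\<^sub>R g (\<gamma> t))"
    by (simp add: scaleR_diff_right)
  moreover have "norm (a + b + c - e) \<le> norm a + norm b + norm c + norm e" for a b c e :: "real ^ 'n"
    by (meson add_mono_thms_linordered_semiring(3) norm_triangle_ineq norm_triangle_ineq4 order.trans)
  ultimately have "norm (q' - \<gamma> (t + h)) \<le> norm (q' - q - h *\<^sub>R g q) + norm (q - \<gamma> t)
      + h * (L * norm (q - \<gamma> t)) + norm (\<gamma> (t + h) - \<gamma> t - h *\<^sub>R g (\<gamma> t))"
    by (smt (verit))
  then show ?thesis using step_err flow_err by (simp add: algebra_simps)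
qed

text \<open>In the conditions on \<delta>, \<open>G * (\<epsilon> / m)\<close> reserves room for
  times between two steps, and \<open>\<delta> \<le> m / L\<close> lets the gradient on the run lose
  at most \<open>m\<close> of the \<open>2 * m\<close> on the flow line. The extra unit of time
  covers the overshoot of the last step.\<close>

lemma algorithm_tracks_flow:
  assumes T: "0 \<le> T" and m: "0 < m" "\<And>t. 0 \<le> t \<Longrightarrow> t \<le> T + 1 \<Longrightarrow> 2 * m \<le> norm (g (\<gamma> t))"
    and \<epsilon>: "0 < \<epsilon>" "\<epsilon> \<le> m" and w: "w = sqrt (4 * L * \<epsilon> / m)" "w \<le> 1"
    and \<delta>: "2 * w * G / L * exp (L * (T + 1)) + G * (\<epsilon> / m) \<le> \<delta>" "\<delta> \<le> m / L"
    and q0: "q 0 = \<gamma> 0" and steps: "\<And>k. algorithm_step f \<epsilon> (q k) (q (Suc k))"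
  obtains N where "\<And>k. k \<le> N \<Longrightarrow> \<exists>t\<ge>0. norm (q k - \<gamma> t) \<le> \<delta>"
    and "\<And>t. 0 \<le> t \<Longrightarrow> t \<le> T \<Longrightarrow> \<exists>k\<le>N. norm (q k - \<gamma> t) \<le> \<delta>"
    and "\<exists>t\<ge>T. norm (q N - \<gamma> t) \<le> \<delta>"
proof -
  \<comment> \<open>\<open>C * (exp (L * t) - 1)\<close> solves
    \<open>e' = L * e + 2 * w * G\<close> with \<open>e 0 = 0\<close>, the continuous form of the
    one-step recursion.\<close>
  define C where "C = 2 * w * G / L"
  define h where "h k = \<epsilon> / norm (g (q k))" for k
  define \<tau> where "\<tau> k = (\<Sum>i<k. h i)" for k
  have \<tau>_simps: "\<tau> 0 = 0" "\<tau> (Suc k) = \<tau> k + h k" for k by (auto simp: \<tau>_def)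
  have h_nonneg: "0 \<le> h k" for k using \<epsilon> by (simp add: h_def)
  have \<tau>_mono: "j \<le> k \<Longrightarrow> \<tau> j \<le> \<tau> k" for j k
    by (rule lift_Suc_mono_le) (use \<tau>_simps h_nonneg in auto)
  have \<tau>_nonneg: "0 \<le> \<tau> k" for k using \<tau>_mono[of 0 k] \<tau>_simps by simp
  have C_nonneg: "0 \<le> C" using w(1) \<epsilon> m L_pos G_pos by (simp add: C_def)
  have CL: "C * L = 2 * w * G" using L_pos by (simp add: C_def)
  have "0 \<le> G * (\<epsilon> / m)" using G_pos \<epsilon> m by simp
  then have C_exp: "C * exp (L * (T + 1)) \<le> \<delta> - G * (\<epsilon> / m)" "C * exp (L * (T + 1)) \<le> \<delta>"
    using \<delta>(1) by (simp_all add: C_def)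
  have C_bound: "C * (exp (L * \<tau> k) - 1) \<le> C * exp (L * (T + 1))" if "\<tau> k \<le> T + 1" for k
  proof (rule mult_left_mono[OF _ C_nonneg])
    have "exp (L * \<tau> k) \<le> exp (L * (T + 1))" using that L_pos by simp
    then show "exp (L * \<tau> k) - 1 \<le> exp (L * (T + 1))" by linarith
  qed
  have noncritical: "m \<le> norm (g (q k))"
    if "\<tau> k \<le> T + 1" "norm (q k - \<gamma> (\<tau> k)) \<le> \<delta>" for k
  proof -
    have "L * norm (q k - \<gamma> (\<tau> k)) \<le> L * (m / L)"
      using that(2) \<delta>(2) L_pos by (intro mult_left_mono) auto
    then have "norm (g (q k) - g (\<gamma> (\<tau> k))) \<le> m"
      using lipschitz[of "q k" "\<gamma> (\<tau> k)"] L_pos by simp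
    moreover have "2 * m \<le> norm (g (\<gamma> (\<tau> k)))" using that(1) \<tau>_nonneg by (intro m)
    ultimately show ?thesis
      using norm_triangle_ineq3[of "g (q k)" "g (\<gamma> (\<tau> k))"] by linarith
  qed
  \<comment> \<open>The induction sustains itself: a small error keeps the gradient at
    \<open>q k\<close> above \<open>m\<close>, and that bound licenses the estimate of the next
    step.\<close>
  have err: "norm (q k - \<gamma> (\<tau> k)) \<le> C * (exp (L * \<tau> k) - 1)" if "\<tau> k \<le> T + 1" for k
    using that
  proof (induction k)
    case 0
    then show ?case by (simp add: q0 \<tau>_simps)
  next
    case (Suc k)
    have \<tau>k: "\<tau> k \<le> T + 1" using Suc.prems \<tau>_mono[of k "Suc k"] by simp
    note IH = Suc.IH[OF \<tau>k]
    have "m \<le> norm (g (q k))"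
      using noncritical[OF \<tau>k] IH C_bound[OF \<tau>k] C_exp(2) by linarith
    then have "norm (q (Suc k) - \<gamma> (\<tau> k + h k)) \<le> (1 + L * h k) * norm (q k - \<gamma> (\<tau> k)) + 2 * w * G * h k"
      using \<epsilon> m steps w \<tau>_nonneg by (intro algorithm_step_flow_error) (auto simp: h_def)
    also have "\<dots> \<le> (1 + L * h k) * (C * (exp (L * \<tau> k) - 1)) + C * L * h k"
      using IH h_nonneg[of k] L_pos by (simp add: CL mult_left_mono)
    also have "\<dots> = C * ((1 + L * h k) * exp (L * \<tau> k) - 1)" by (simp add: algebra_simps)
    also have "\<dots> \<le> C * (exp (L * h k) * exp (L * \<tau> k) - 1)"
      using C_nonneg exp_ge_add_one_self[of "L * h k"]
      by (intro mult_left_mono diff_right_mono mult_right_mono) auto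
    also have "\<dots> = C * (exp (L * \<tau> (Suc k)) - 1)"
      by (simp add: \<tau>_simps distrib_left exp_add mult.commute)
    finally show ?case by (simp add: \<tau>_simps)
  qed
  have err_bound: "norm (q k - \<gamma> (\<tau> k)) \<le> \<delta> - G * (\<epsilon> / m)" "norm (q k - \<gamma> (\<tau> k)) \<le> \<delta>"
    if "\<tau> k \<le> T + 1" for k
    using err[OF that] C_bound[OF that] C_exp by linarith+
  have h_le: "h k \<le> \<epsilon> / m" if "\<tau> k \<le> T + 1" for k
    unfolding h_def using noncritical[OF that err_bound(2)[OF that]] m(1) \<epsilon>
    by (intro frac_le) linarith+
  have h_ge: "\<epsilon> / G \<le> h k" if "\<tau> k \<le> T + 1" for k
    unfolding h_def using noncritical[OF that err_bound(2)[OF that]] bounded[of "q k"] m(1) \<epsilon>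
    by (intro frac_le) linarith+
  \<comment> \<open>The clock \<tau> cannot stall before \<open>T\<close>, as each step takes at
    least time \<open>\<epsilon> / G\<close>.\<close>
  have "\<exists>k. T \<le> \<tau> k"
  proof (rule ccontr)
    assume "\<nexists>k. T \<le> \<tau> k"
    then have less: "\<tau> k < T" for k by (simp add: not_le)
    have lower: "real k * (\<epsilon> / G) \<le> \<tau> k" for k
    proof (induction k)
      case (Suc k)
      then show ?case using h_ge[of k] less[of k] by (simp add: \<tau>_simps distrib_right add_divide_distrib)
    qed (simp add: \<tau>_simps)
    have "0 < \<epsilon> / G" using \<epsilon> G_pos by simp
    then obtain k where "T < real k * (\<epsilon> / G)" using reals_Archimedean3 by blast
    then show False using lower[of k] less[of k] by linarith
  qed
  define N where "N = (LEAST k. T \<le> \<tau> k)"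
  have N: "T \<le> \<tau> N" unfolding N_def using \<open>\<exists>k. T \<le> \<tau> k\<close> by (rule LeastI_ex)
  have before_N: "\<tau> k < T" if "k < N" for k
    using that not_less_Least unfolding N_def by (metis not_le)
  \<comment> \<open>If \<open>N\<close> is not 0, its minimality puts the clock below
    \<open>T\<close> one step earlier, and that step took at most
    \<open>\<epsilon> / m \<le> 1\<close>.\<close>
  have "\<tau> N \<le> T + 1"
  proof (cases N)
    case 0
    then show ?thesis using T by (simp add: \<tau>_simps)
  next
    case (Suc k)
    have "\<tau> k < T" using before_N Suc by simp
    moreover have "\<epsilon> / m \<le> 1" using \<epsilon> m by simp
    ultimately show ?thesis using h_le[of k] by (simp add: Suc \<tau>_simps)
  qed
  then have \<tau>_le: "\<tau> k \<le> T + 1" if "k \<le> N" for k using \<tau>_mono[OF that] by linarith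
  show thesis
  proof
    show "\<exists>t\<ge>0. norm (q k - \<gamma> t) \<le> \<delta>" if "k \<le> N" for k
      using err_bound(2)[OF \<tau>_le[OF that]] \<tau>_nonneg by blast
    show "\<exists>t\<ge>T. norm (q N - \<gamma> t) \<le> \<delta>"
      using err_bound(2)[OF \<tau>_le[of N]] N by blast
    show "\<exists>k\<le>N. norm (q k - \<gamma> t) \<le> \<delta>" if t: "0 \<le> t" "t \<le> T" for t
    proof -
      \<comment> \<open>Unless \<open>k\<close> is 0, the vertex for \<open>t\<close> is the one
        before the clock reaches \<open>t\<close>; the flow moves at most
        \<open>G * (\<epsilon> / m)\<close> in between.\<close>
      define k where "k = (LEAST k. t \<le> \<tau> k)"
      have tN: "t \<le> \<tau> N" using t N by simp
      then have k: "t \<le> \<tau> k" "k \<le> N" unfolding k_def by (rule LeastI, rule Least_le)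
      show ?thesis
      proof (cases k)
        case 0
        then have "t = \<tau> 0" using k t by (simp add: \<tau>_simps)
        then show ?thesis using err_bound(2)[OF \<tau>_le[of 0]] by auto
      next
        case (Suc j)
        have j: "\<tau> j < t" "j \<le> N"
          using not_less_Least[of j "\<lambda>k. t \<le> \<tau> k"] Suc k(2) unfolding k_def[symmetric] by auto
        have "\<tau> j \<le> T + 1" using \<tau>_le j by simp
        have "norm (\<gamma> (\<tau> j) - \<gamma> t) \<le> G * \<bar>\<tau> j - t\<bar>" using \<tau>_nonneg t by (intro flow_lipschitz)
        also have "\<dots> \<le> G * (\<epsilon> / m)"
          using h_le[OF \<open>\<tau> j \<le> T + 1\<close>] k(1) j G_pos
          by (intro mult_left_mono) (auto simp: Suc \<tau>_simps)
        finally have "norm (q j - \<gamma> t) \<le> \<delta>"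
          using err_bound(1)[OF \<open>\<tau> j \<le> T + 1\<close>] norm_triangle_ineq[of "q j - \<gamma> (\<tau> j)" "\<gamma> (\<tau> j) - \<gamma> t"]
          by simp
        then show ?thesis using j by blast
      qed
    qed
  qed
qed

text \<open>On the compact interval up to \<open>T + 1\<close> the gradient norm attains a positive
  minimum, which supplies \<open>m\<close>. With \<open>T\<close> and \<open>m\<close> fixed, the
  whole error bound tends to 0 with \<epsilon>.\<close>

lemma algorithm_tracks_flow_eventually:
  assumes T: "0 \<le> T" and noncrit: "\<And>t. 0 \<le> t \<Longrightarrow> g (\<gamma> t) \<noteq> 0" and \<rho>: "0 < \<rho>"
  shows "\<forall>\<^sub>F \<epsilon> in at_right 0. \<forall>q. q 0 = \<gamma> 0 \<and> (\<forall>k. algorithm_step f \<epsilon> (q k) (q (Suc k))) \<longrightarrow>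
    (\<exists>N. (\<forall>k\<le>N. \<exists>t\<ge>0. norm (q k - \<gamma> t) \<le> \<rho>) \<and>
         (\<forall>t. 0 \<le> t \<and> t \<le> T \<longrightarrow> (\<exists>k\<le>N. norm (q k - \<gamma> t) \<le> \<rho>)) \<and>
         (\<exists>t\<ge>T. norm (q N - \<gamma> t) \<le> \<rho>))"
proof -
  have "continuous_on UNIV g"
    using lipschitz L_pos by (intro lipschitz_on_continuous_on[of L])
      (auto simp: lipschitz_on_def dist_norm)
  moreover have "continuous_on {0..T + 1} \<gamma>"
    using continuous_on_flow by (rule continuous_on_subset) simp
  ultimately have cont: "continuous_on {0..T + 1} (\<lambda>t. norm (g (\<gamma> t)))"
    by (metis continuous_on_compose2 continuous_on_norm subset_UNIV)
  have "{0..T + 1} \<noteq> {}" using T by simp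
  from continuous_attains_inf[OF compact_Icc this cont] obtain t0 where t0: "0 \<le> t0" "t0 \<le> T + 1"
    and min: "\<And>t. 0 \<le> t \<Longrightarrow> t \<le> T + 1 \<Longrightarrow> norm (g (\<gamma> t0)) \<le> norm (g (\<gamma> t))"
    by auto
  define m where "m = norm (g (\<gamma> t0)) / 2"
  have m: "0 < m" using noncrit[OF t0(1)] by (simp add: m_def)
  have m2: "2 * m \<le> norm (g (\<gamma> t))" if "0 \<le> t" "t \<le> T + 1" for t
    using min[OF that] by (simp add: m_def)
  define \<delta> where "\<delta> = min \<rho> (m / L)"
  have \<delta>: "0 < \<delta>" "\<delta> \<le> \<rho>" "\<delta> \<le> m / L" using \<rho> m L_pos by (auto simp: \<delta>_def)
  have "((\<lambda>\<epsilon>. sqrt (4 * L * \<epsilon> / m)) \<longlongrightarrow> sqrt (4 * L * 0 / m)) (at_right 0)"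
    using m by (intro tendsto_intros) auto
  then have lim_w: "((\<lambda>\<epsilon>. sqrt (4 * L * \<epsilon> / m)) \<longlongrightarrow> 0) (at_right 0)" by simp
  have "((\<lambda>\<epsilon>. 2 * sqrt (4 * L * \<epsilon> / m) * G / L * exp (L * (T + 1)) + G * (\<epsilon> / m)) \<longlongrightarrow>
      2 * 0 * G / L * exp (L * (T + 1)) + G * (0 / m)) (at_right 0)"
    using m L_pos by (intro tendsto_intros lim_w) auto
  then have "((\<lambda>\<epsilon>. 2 * sqrt (4 * L * \<epsilon> / m) * G / L * exp (L * (T + 1)) + G * (\<epsilon> / m)) \<longlongrightarrow> 0)
      (at_right 0)" by simp
  then have "\<forall>\<^sub>F \<epsilon> in at_right 0.
      2 * sqrt (4 * L * \<epsilon> / m) * G / L * exp (L * (T + 1)) + G * (\<epsilon> / m) < \<delta>"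
    by (rule order_tendstoD) (rule \<delta>)
  moreover have "\<forall>\<^sub>F \<epsilon> in at_right 0. sqrt (4 * L * \<epsilon> / m) < 1"
    using lim_w by (rule order_tendstoD) simp
  moreover have "\<forall>\<^sub>F \<epsilon> in at_right 0. 0 < \<epsilon> \<and> \<epsilon> < m"
    using m by (auto simp: eventually_at_right_field)
  ultimately show ?thesis
  proof eventually_elim
    case (elim \<epsilon>)
    show ?case
    proof (intro allI impI, elim conjE)
      fix q
      assume "q 0 = \<gamma> 0" and "\<forall>k. algorithm_step f \<epsilon> (q k) (q (Suc k))"
      then obtain N where "\<And>k. k \<le> N \<Longrightarrow> \<exists>t\<ge>0. norm (q k - \<gamma> t) \<le> \<delta>"
        and "\<And>t. 0 \<le> t \<Longrightarrow> t \<le> T \<Longrightarrow> \<exists>k\<le>N. norm (q k - \<gamma> t) \<le> \<delta>"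
        and "\<exists>t\<ge>T. norm (q N - \<gamma> t) \<le> \<delta>"
        using elim algorithm_tracks_flow[OF T m m2 _ _ refl _ _ \<delta>(3), of \<epsilon> q] by (metis less_imp_le)
      then show "\<exists>N. (\<forall>k\<le>N. \<exists>t\<ge>0. norm (q k - \<gamma> t) \<le> \<rho>) \<and>
         (\<forall>t. 0 \<le> t \<and> t \<le> T \<longrightarrow> (\<exists>k\<le>N. norm (q k - \<gamma> t) \<le> \<rho>)) \<and>
         (\<exists>t\<ge>T. norm (q N - \<gamma> t) \<le> \<rho>)"
        using order.trans[OF _ \<delta>(2)] by (intro exI[of _ N]) blast
    qed
  qed
qed

lemma algorithm_converges_to_flow:
  assumes lim: "(\<gamma> \<longlongrightarrow> z) at_top"
    and grad: "\<And>y. y \<in> cball z d \<Longrightarrow> c * (norm (z - y))\<^sup>2 \<le> g y \<bullet> (z - y)"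
    and c: "0 < c" and d: "0 < d" and \<eta>: "0 < \<eta>"
  shows "\<forall>\<^sub>F \<epsilon> in at_right 0. \<forall>q. q 0 = \<gamma> 0 \<and> (\<forall>k. algorithm_step f \<epsilon> (q k) (q (Suc k))) \<longrightarrow>
    (\<exists>k. q k = z) \<and> (\<forall>k. \<exists>t\<ge>0. norm (q k - \<gamma> t) \<le> \<eta>) \<and> (\<forall>t\<ge>0. \<exists>k. norm (q k - \<gamma> t) \<le> \<eta>)"
proof -
  define r where "r = min \<eta> d"
  have r: "0 < r" "r \<le> \<eta>" "r \<le> d" using \<eta> d by (auto simp: r_def)
  have "(f \<longlongrightarrow> f z) (nhds z)" using isCont_f[of z] by (simp add: continuous_within tendsto_at_iff_tendsto_nhds)
  moreover have "f z - c / 2 * (r / 2)\<^sup>2 < f z" using c r by simp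
  ultimately have "\<forall>\<^sub>F y in nhds z. f z - c / 2 * (r / 2)\<^sup>2 < f y" by (rule order_tendstoD)
  then obtain \<sigma> where \<sigma>: "0 < \<sigma>" "\<And>y. dist y z < \<sigma> \<Longrightarrow> f z - c / 2 * (r / 2)\<^sup>2 < f y"
    unfolding eventually_nhds_metric by blast
  \<comment> \<open>The run at step \<open>N\<close> is \<rho>-close to the tail of the flow line,
    which is \<rho>-close to \<open>z\<close>. The sum \<open>2 * \<rho>\<close> must lie below
    \<open>r\<close> for absorption to start and below \<sigma> for the level bound.\<close>
  define \<rho> where "\<rho> = min r \<sigma> / 3"
  have \<rho>: "0 < \<rho>" "2 * \<rho> < r" "2 * \<rho> < \<sigma>" using r \<sigma> by (auto simp: \<rho>_def)
  let ?run = "\<lambda>\<epsilon> q. q 0 = \<gamma> 0 \<and> (\<forall>k. algorithm_step f \<epsilon> (q k) (q (Suc k)))"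
  \<comment> \<open>One statement covers both cases, since the tracking estimate excludes flow lines
    through a critical point. Such a flow line is constantly \<open>z\<close>, the run starts there,
    and \<open>T = 0\<close>, \<open>N = 0\<close> work for every \<epsilon>.\<close>
  have "\<exists>T\<ge>0. (\<forall>t\<ge>T. norm (z - \<gamma> t) \<le> \<rho>) \<and>
    (\<forall>\<^sub>F \<epsilon> in at_right 0. \<forall>q. ?run \<epsilon> q \<longrightarrow>
      (\<exists>N. (\<forall>k\<le>N. \<exists>t\<ge>0. norm (q k - \<gamma> t) \<le> \<rho>) \<and>
         (\<forall>t. 0 \<le> t \<and> t \<le> T \<longrightarrow> (\<exists>k\<le>N. norm (q k - \<gamma> t) \<le> \<rho>)) \<and>
         (\<exists>t\<ge>T. norm (q N - \<gamma> t) \<le> \<rho>)))"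
  proof (cases "\<exists>t\<ge>0. g (\<gamma> t) = 0")
    case True
    then have const: "\<gamma> t = \<gamma> 0" if "0 \<le> t" for t
      using flow_constant_of_critical that order.refl by metis
    have "\<forall>\<^sub>F t in at_top. \<gamma> t = \<gamma> 0"
      by (rule eventually_at_top_linorderI) (rule const)
    then have "((\<lambda>t::real. \<gamma> 0) \<longlongrightarrow> z) at_top"
      by (rule Lim_transform_eventually[OF lim])
    then have "\<gamma> 0 = z" by (simp add: tendsto_const_iff)
    with const \<rho> have *: "\<forall>t\<ge>0. \<gamma> t = z" by simp
    show ?thesis
      by (rule exI[of _ 0]) (use * \<rho> in \<open>auto intro!: always_eventually exI[of _ "0::nat"] exI[of _ "0::real"]\<close>)
  next
    case False
    have "\<forall>\<^sub>F t in at_top. dist (\<gamma> t) z < \<rho>" using lim \<rho> by (auto intro: tendstoD)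
    then obtain T where "\<And>t. T \<le> t \<Longrightarrow> dist (\<gamma> t) z < \<rho>" by (auto simp: eventually_at_top_linorder)
    then have "\<forall>t\<ge>max T 0. norm (z - \<gamma> t) \<le> \<rho>"
      by (auto simp: dist_norm norm_minus_commute intro: less_imp_le)
    moreover have "0 \<le> max T 0" by simp
    ultimately show ?thesis
      using algorithm_tracks_flow_eventually[of "max T 0" \<rho>] False \<rho>(1) by blast
  qed
  then obtain T where T: "0 \<le> T" "\<And>t. T \<le> t \<Longrightarrow> norm (z - \<gamma> t) \<le> \<rho>"
    and track: "\<forall>\<^sub>F \<epsilon> in at_right 0. \<forall>q. ?run \<epsilon> q \<longrightarrow>
      (\<exists>N. (\<forall>k\<le>N. \<exists>t\<ge>0. norm (q k - \<gamma> t) \<le> \<rho>) \<and>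
         (\<forall>t. 0 \<le> t \<and> t \<le> T \<longrightarrow> (\<exists>k\<le>N. norm (q k - \<gamma> t) \<le> \<rho>)) \<and>
         (\<exists>t\<ge>T. norm (q N - \<gamma> t) \<le> \<rho>))"
    by blast
  have "\<forall>\<^sub>F \<epsilon> in at_right 0. 0 < \<epsilon> \<and> \<epsilon> < r / 2"
    using r by (auto simp: eventually_at_right_field intro!: exI[of _ "r / 2"])
  with track show ?thesis
  proof eventually_elim
    case (elim \<epsilon>)
    show ?case
    proof (intro allI impI)
      fix q
      assume run: "?run \<epsilon> q"
      from elim(1)[THEN spec, THEN mp, OF run] obtain N where
        N: "\<forall>k\<le>N. \<exists>t\<ge>0. norm (q k - \<gamma> t) \<le> \<rho>"
          "\<forall>t. 0 \<le> t \<and> t \<le> T \<longrightarrow> (\<exists>k\<le>N. norm (q k - \<gamma> t) \<le> \<rho>)"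
          "\<exists>t\<ge>T. norm (q N - \<gamma> t) \<le> \<rho>"
        by (rule exE) (elim conjE, rule that)
      from N(3) obtain t where t: "T \<le> t" "norm (q N - \<gamma> t) \<le> \<rho>" by blast
      have qN: "norm (z - q N) \<le> 2 * \<rho>"
        using norm_triangle_ineq4[of "z - \<gamma> t" "q N - \<gamma> t"] T(2)[OF t(1)] t(2) by simp
      then have "f z - c / 2 * (r / 2)\<^sup>2 < f (q N)"
        using \<rho> by (intro \<sigma>) (simp add: dist_norm norm_minus_commute)
      then have start: "norm (z - q N) \<le> r" "f z - c / 2 * (r / 2)\<^sup>2 \<le> f (q N)"
        using qN \<rho> by linarith+
      have \<epsilon>: "0 < \<epsilon>" "\<epsilon> \<le> r / 2" and steps: "algorithm_step f \<epsilon> (q k) (q (Suc k))" for k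
        using elim(2) run by auto
      note absorbed_by_z = algorithm_absorbed_by_nondegenerate_max
        [where z = z and c = c and d = d and q = q, OF _ c r(1,3) \<epsilon> steps start]
      have absorbed: "norm (z - q k) \<le> r / 2" if "N \<le> k" for k
        using that by (rule absorbed_by_z(1)[rotated]) (rule grad)
      have returns: "\<exists>k. q k = z"
        by (rule absorbed_by_z(2)) (rule grad)
      \<comment> \<open>After step \<open>N\<close> the point \<open>\<gamma> T\<close> serves for
        all vertices: the distances \<open>r / 2\<close> and \<rho> to \<open>z\<close> add up to
        less than \<eta>.\<close>
      have "\<exists>t\<ge>0. norm (q k - \<gamma> t) \<le> \<eta>" for k
      proof (cases "k \<le> N")
        case True
        then obtain t where "0 \<le> t" "norm (q k - \<gamma> t) \<le> \<rho>" using N(1) by blast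
        moreover have "\<rho> \<le> \<eta>" using \<rho> r by linarith
        ultimately show ?thesis by (meson order.trans)
      next
        case False
        then have "norm (z - q k) \<le> r / 2" using absorbed by simp
        then have "norm (q k - \<gamma> T) \<le> \<eta>"
          using norm_triangle_ineq4[of "z - \<gamma> T" "z - q k"] T(2)[of T] \<rho> r by simp
        then show ?thesis using T(1) by blast
      qed
      moreover have "\<exists>k. norm (q k - \<gamma> t) \<le> \<eta>" if "0 \<le> t" for t
      proof (cases "t \<le> T")
        case True
        then obtain k where "norm (q k - \<gamma> t) \<le> \<rho>" using N(2) \<open>0 \<le> t\<close> by blast
        then have "norm (q k - \<gamma> t) \<le> \<eta>" using \<rho> r by linarith
        then show ?thesis ..
      next
        case False
        then have "norm (q N - \<gamma> t) \<le> \<eta>"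
          using norm_triangle_ineq4[of "z - \<gamma> t" "z - q N"] T(2)[of t] absorbed[of N] \<rho> r by simp
        then show ?thesis ..
      qed
      ultimately show "(\<exists>k. q k = z) \<and> (\<forall>k. \<exists>t\<ge>0. norm (q k - \<gamma> t) \<le> \<eta>) \<and>
          (\<forall>t\<ge>0. \<exists>k. norm (q k - \<gamma> t) \<le> \<eta>)"
        using returns by blast
    qed
  qed
qed

end

section \<open>Consequences of the standing assumptions; the Hausdorff distance\<close>

text \<open>The norm of a matrix here is the Euclidean norm of its entries; Cauchy-Schwarz row by
  row shows that it dominates the operator norm, which gives the gradient its Lipschitz
  constant.\<close>

lemma norm_matrix_vector_mult_le:
  fixes A :: "real ^ 'n ^ 'm"
  shows "norm (A *v v) \<le> norm A * norm v"
proof -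
  have "norm (A *v v) = L2_set (\<lambda>i. norm (A $ i \<bullet> v)) UNIV"
    by (simp add: norm_vec_def matrix_vector_mult_def inner_vec_def)
  also have "\<dots> \<le> L2_set (\<lambda>i. norm (A $ i) * norm v) UNIV"
    by (intro L2_set_mono) (auto simp: Cauchy_Schwarz_ineq2)
  also have "\<dots> = norm A * norm v"
    by (simp add: norm_vec_def[of A] L2_set_left_distrib)
  finally show ?thesis .
qed

text \<open>The definite description needs existence and uniqueness: the adjoint of the derivative,
  applied to 1, represents it as an inner product, and a vector is determined by its inner
  products.\<close>

lemma GDERIV_gradient:
  fixes f :: "real ^ 'n \<Rightarrow> real"
  assumes "f differentiable at x"
  shows "GDERIV f x :> gradient f x"
proof -
  obtain D where D: "(f has_derivative D) (at x)"
    using assms by (auto simp: differentiable_def)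
  then have "linear D" by (rule has_derivative_linear)
  then have "D = (\<lambda>h. h \<bullet> adjoint D 1)"
    using adjoint_works[of D] by (simp add: fun_eq_iff inner_real_def)
  then have G: "GDERIV f x :> adjoint D 1"
    using D by (simp add: gderiv_def)
  have "E = adjoint D 1" if "GDERIV f x :> E" for E
  proof -
    have "(\<lambda>h. h \<bullet> E) = (\<lambda>h. h \<bullet> adjoint D 1)"
      using that G unfolding gderiv_def by (rule has_derivative_unique)
    then show ?thesis by (metis inner_commute vector_eq_rdot)
  qed
  then show ?thesis unfolding gradient_def using G by (metis theI)
qed

lemma standing_assumptionsD:
  assumes "standing_assumptions f"
  shows "(gradient f has_derivative (\<lambda>h. hessian f y *v h)) (at y)"
    and "gradient f y = 0 \<Longrightarrow> hessian f y *v v = 0 \<Longrightarrow> v = 0"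
    and "\<exists>L G. lipschitz_gradient f (gradient f) L G"
proof -
  show H: "(gradient f has_derivative (\<lambda>h. hessian f y *v h)) (at y)" for y
    using assms jacobian_works[of "gradient f" "at y"]
    by (simp add: standing_assumptions_def twice_continuously_differentiable_def hessian_def)
  show "v = 0" if "gradient f y = 0" "hessian f y *v v = 0"
  proof -
    have "invertible (hessian f y)" using assms that by (simp add: standing_assumptions_def)
    then show ?thesis
      using that(2) matrix_left_invertible_ker[of "hessian f y"] by (auto simp: invertible_def)
  qed
  obtain L where L: "0 < L" "\<And>y. norm (hessian f y) \<le> L"
    using assms by (auto simp: standing_assumptions_def bounded_pos)
  obtain G where G: "0 < G" "\<And>y. norm (gradient f y) \<le> G"
    using assms by (auto simp: standing_assumptions_def bounded_pos)
  have "lipschitz_gradient f (gradient f) L G"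
  proof
    show "GDERIV f y :> gradient f y" for y
      using assms
      by (intro GDERIV_gradient)
        (simp add: standing_assumptions_def twice_continuously_differentiable_def)
    have "onorm (\<lambda>h. hessian f y *v h) \<le> L" for y
      using L by (intro onorm_bound
        order.trans[OF norm_matrix_vector_mult_le mult_right_mono[OF L(2) norm_ge_zero]]) simp
    then show "norm (gradient f y - gradient f z) \<le> L * norm (y - z)" for y z
      using H by (intro differentiable_bound[of UNIV]) auto
  qed (use L G in auto)
  then show "\<exists>L G. lipschitz_gradient f (gradient f) L G" by blast
qed

lemma hausdorff_distance_le:
  assumes "\<And>a. a \<in> A \<Longrightarrow> \<exists>b\<in>B. norm (a - b) \<le> \<eta>" and "\<And>b. b \<in> B \<Longrightarrow> \<exists>a\<in>A. norm (a - b) \<le> \<eta>"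
  shows "hausdorff_distance A B \<le> ereal \<eta>"
  unfolding hausdorff_distance_def
proof (intro max.boundedI SUP_least)
  show "(INF b\<in>B. ereal (norm (a - b))) \<le> ereal \<eta>" if "a \<in> A" for a
    using assms(1)[OF that] by (auto intro: INF_lower2)
  show "(INF a\<in>A. ereal (norm (a - b))) \<le> ereal \<eta>" if "b \<in> B" for b
    using assms(2)[OF that] by (auto intro: INF_lower2)
qed

text \<open>A supremum over the empty set is minus infinity in the extended reals, so a point of
  \<open>A\<close> is exhibited.\<close>

lemma hausdorff_distance_nonneg:
  assumes "a \<in> A"
  shows "0 \<le> hausdorff_distance A B"
proof -
  have "0 \<le> (INF b\<in>B. ereal (norm (a - b)))" by (intro INF_greatest) simp
  also have "\<dots> \<le> (SUP a\<in>A. INF b\<in>B. ereal (norm (a - b)))" using assms by (rule SUP_upper)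
  finally show ?thesis by (simp add: hausdorff_distance_def le_max_iff_disj)
qed

lemma run_returnsI:
  assumes \<epsilon>: "0 \<le> \<epsilon>" and max: "\<And>y. y \<in> cball p \<epsilon> \<Longrightarrow> f y \<le> f p"
    and steps: "\<And>k. algorithm_step f \<epsilon> (q k) (q (Suc k))" and k: "q k = p"
  shows "run_returns q p"
proof -
  \<comment> \<open>Arrival at \<open>p\<close> is not yet stopping: \<open>stopped\<close>
    registers the trivial step that follows, hence the index \<open>Suc k\<close>.\<close>
  have "q (Suc k) = p"
    using algorithm_step_at_maximum[where f = f and q = p, OF \<epsilon> max] steps[of k] k by simp
  then have "stopped q (Suc k)" "q (Suc k) = p" using k by (auto simp: stopped_def)
  then show ?thesis unfolding run_returns_def by blast
qed

text \<open>Existence of a run keeps the claim about all runs from being vacuous. \<open>Q\<close>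
  is an arbitrary selection of runs, one for each small \<epsilon>, so the convergence holds
  whichever projections are chosen.\<close>

theorem theorem3p2:
  fixes f :: "real ^ 'n \<Rightarrow> real" and x x_star :: "real ^ 'n" and \<gamma> :: "real \<Rightarrow> real ^ 'n"
  assumes "standing_assumptions f"
    and "mode f x_star"
    and "gradient_flow f x \<gamma>"
    and "(\<gamma> \<longlongrightarrow> x_star) at_top"
  shows "(\<exists>\<epsilon>\<^sub>0>0. \<forall>\<epsilon>. 0 < \<epsilon> \<and> \<epsilon> \<le> \<epsilon>\<^sub>0 \<longrightarrow>
            (\<exists>q. algorithm_run f \<epsilon> x q) \<and>
            (\<forall>q. algorithm_run f \<epsilon> x q \<longrightarrow> run_returns q x_star)) \<and>
         (\<forall>Q. (\<forall>\<^sub>F \<epsilon> in at_right 0. algorithm_run f \<epsilon> x (Q \<epsilon>)) \<longrightarrow>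
            ((\<lambda>\<epsilon>. hausdorff_distance (polygonal_line (Q \<epsilon>)) (\<gamma> ` {0..})) \<longlongrightarrow> 0) (at_right 0))"
proof -
  let ?g = "gradient f"
  obtain L G where "lipschitz_gradient f ?g L G"
    using standing_assumptionsD(3)[OF assms(1)] by blast
  then interpret lipschitz_gradient f ?g L G .
  interpret lipschitz_gradient_flow f ?g L G \<gamma>
    by unfold_locales (use assms(3) in \<open>simp add: gradient_flow_def\<close>)
  have x: "\<gamma> 0 = x" using assms(3) by (simp add: gradient_flow_def)
  obtain r where r: "0 < r" and max: "\<And>y. y \<in> ball x_star r \<Longrightarrow> f y \<le> f x_star"
    using assms(2) by (auto simp: mode_def)
  have crit: "?g x_star = 0" using r max by (rule gradient_zero_at_local_max)
  obtain c d where c: "0 < c" and d: "0 < d"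
    and grad: "\<And>y. y \<in> cball x_star d \<Longrightarrow> c * (norm (x_star - y))\<^sup>2 \<le> ?g y \<bullet> (x_star - y)"
  proof (rule gradient_points_to_nondegenerate_local_max)
    show "(?g has_derivative (\<lambda>h. hessian f x_star *v h)) (at x_star)"
      using assms(1) by (rule standing_assumptionsD)
    show "v = 0" if "hessian f x_star *v v = 0" for v
      using assms(1) crit that by (rule standing_assumptionsD)
  qed (use r max that in blast)+
  let ?run = "\<lambda>\<epsilon> q. \<forall>k. algorithm_step f \<epsilon> (q k) (q (Suc k))"
  have conv: "\<forall>\<^sub>F \<epsilon> in at_right 0. \<forall>q. algorithm_run f \<epsilon> x q \<longrightarrow>
      ?run \<epsilon> q \<and> (\<exists>k. q k = x_star) \<and>
      (\<forall>k. \<exists>t\<ge>0. norm (q k - \<gamma> t) \<le> \<eta>) \<and> (\<forall>t\<ge>0. \<exists>k. norm (q k - \<gamma> t) \<le> \<eta>)"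
    if \<eta>: "0 < \<eta>" for \<eta>
  proof -
    have "\<forall>\<^sub>F \<epsilon> in at_right 0. \<forall>q. q 0 = \<gamma> 0 \<and> ?run \<epsilon> q \<longrightarrow>
        (\<exists>k. q k = x_star) \<and> (\<forall>k. \<exists>t\<ge>0. norm (q k - \<gamma> t) \<le> \<eta>) \<and>
        (\<forall>t\<ge>0. \<exists>k. norm (q k - \<gamma> t) \<le> \<eta>)"
      by (rule algorithm_converges_to_flow[OF assms(4) _ c d \<eta>]) (rule grad)
    then show ?thesis
      using eventually_at_right_less[of 0]
      by eventually_elim (use algorithm_run_iff[OF continuous_on_f] x in auto)
  qed
  have small: "\<forall>\<^sub>F \<epsilon> in at_right 0. 0 < \<epsilon> \<and> \<epsilon> < b" if "0 < b" for b :: real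
    using that by (auto simp: eventually_at_right_field)
  have "\<forall>\<^sub>F \<epsilon> in at_right 0. (\<exists>q. algorithm_run f \<epsilon> x q) \<and>
      (\<forall>q. algorithm_run f \<epsilon> x q \<longrightarrow> run_returns q x_star)"
    \<comment> \<open>The tolerance 1 is arbitrary, as only the arrival at \<open>x_star\<close>
      matters here; \<open>\<epsilon> < r\<close> puts the closed ball inside the ball where
      \<open>x_star\<close> maximises \<open>f\<close>.\<close>
    using conv[OF zero_less_one] small[OF r]
  proof eventually_elim
    case (elim \<epsilon>)
    have "run_returns q x_star" if "algorithm_run f \<epsilon> x q" for q
    proof -
      have "f y \<le> f x_star" if "y \<in> cball x_star \<epsilon>" for y using that elim(2) by (intro max) auto
      then show ?thesis
        using elim that run_returnsI[of \<epsilon> x_star f q] by (metis less_imp_le)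
    qed
    then show ?case using algorithm_run_exists[OF continuous_on_f] elim(2) by simp
  qed
  then obtain b where b: "0 < b" "\<And>\<epsilon>. 0 < \<epsilon> \<Longrightarrow> \<epsilon> < b \<Longrightarrow> (\<exists>q. algorithm_run f \<epsilon> x q) \<and>
      (\<forall>q. algorithm_run f \<epsilon> x q \<longrightarrow> run_returns q x_star)"
    unfolding eventually_at_right_field by blast
  have "((\<lambda>\<epsilon>. hausdorff_distance (polygonal_line (Q \<epsilon>)) (\<gamma> ` {0..})) \<longlongrightarrow> 0) (at_right 0)"
    if Q: "\<forall>\<^sub>F \<epsilon> in at_right 0. algorithm_run f \<epsilon> x (Q \<epsilon>)" for Q
  proof (rule order_tendstoI)
    have vertex: "Q \<epsilon> k \<in> polygonal_line (Q \<epsilon>)" for \<epsilon> k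
      by (auto simp: polygonal_line_def)
    show "\<forall>\<^sub>F \<epsilon> in at_right 0. a < hausdorff_distance (polygonal_line (Q \<epsilon>)) (\<gamma> ` {0..})"
      if "a < 0" for a
      using less_le_trans[OF that hausdorff_distance_nonneg[OF vertex]] by simp
    fix a :: ereal
    assume "0 < a"
    then obtain \<eta> where \<eta>: "0 < \<eta>" "ereal \<eta> < a"
      using ereal_dense2[of 0 a] by (auto simp: zero_ereal_def)
    \<comment> \<open>Half of \<eta> goes to the vertices, the other half to the distance from a
      point of an edge to its first vertex, which is at most \<epsilon>.\<close>
    then have "0 < \<eta> / 2" by simp
    from Q conv[OF this] small[OF this]
    show "\<forall>\<^sub>F \<epsilon> in at_right 0. hausdorff_distance (polygonal_line (Q \<epsilon>)) (\<gamma> ` {0..}) < a"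
    proof eventually_elim
      case (elim \<epsilon>)
      then have steps: "algorithm_step f \<epsilon> (Q \<epsilon> k) (Q \<epsilon> (Suc k))"
        and near: "\<exists>t\<ge>0. norm (Q \<epsilon> k - \<gamma> t) \<le> \<eta> / 2"
        and cover: "0 \<le> t \<Longrightarrow> \<exists>k. norm (Q \<epsilon> k - \<gamma> t) \<le> \<eta> / 2" for k t
        by auto
      have "hausdorff_distance (polygonal_line (Q \<epsilon>)) (\<gamma> ` {0..}) \<le> ereal \<eta>"
      proof (rule hausdorff_distance_le)
        fix p
        assume "p \<in> polygonal_line (Q \<epsilon>)"
        then obtain k where p: "p \<in> closed_segment (Q \<epsilon> k) (Q \<epsilon> (Suc k))"
          by (auto simp: polygonal_line_def)
        obtain t where t: "0 \<le> t" "norm (Q \<epsilon> k - \<gamma> t) \<le> \<eta> / 2" using near by blast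
        have "norm (p - Q \<epsilon> k) \<le> norm (Q \<epsilon> (Suc k) - Q \<epsilon> k)"
          using segment_bound(1)[OF p] by simp
        also have "\<dots> \<le> \<epsilon>"
          using steps elim(3) by (intro algorithm_stepD(1)[OF continuous_on_f]) auto
        finally have "norm (p - \<gamma> t) \<le> \<eta>"
          using norm_triangle_ineq[of "p - Q \<epsilon> k" "Q \<epsilon> k - \<gamma> t"] t(2) elim(3) by simp
        then show "\<exists>b\<in>\<gamma> ` {0..}. norm (p - b) \<le> \<eta>" using t(1) by auto
      next
        fix p
        assume "p \<in> \<gamma> ` {0..}"
        then obtain t where "0 \<le> t" "p = \<gamma> t" by auto
        then obtain k where "norm (Q \<epsilon> k - p) \<le> \<eta> / 2" using cover by blast
        then have "norm (Q \<epsilon> k - p) \<le> \<eta>" using \<eta> by simp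
        then show "\<exists>a\<in>polygonal_line (Q \<epsilon>). norm (a - p) \<le> \<eta>" using vertex by blast
      qed
      then show ?case using \<eta>(2) by (rule le_less_trans)
    qed
  qed
  moreover have "\<exists>\<epsilon>\<^sub>0>0. \<forall>\<epsilon>. 0 < \<epsilon> \<and> \<epsilon> \<le> \<epsilon>\<^sub>0 \<longrightarrow>
      (\<exists>q. algorithm_run f \<epsilon> x q) \<and> (\<forall>q. algorithm_run f \<epsilon> x q \<longrightarrow> run_returns q x_star)"
    using b by (intro exI[of _ "b / 2"]) auto
  ultimately show ?thesis by blast
qed

end
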